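(* Let $(X,\Xi)$ be a fixed measurable space. Consider the category in which each object is a Radon subprobability kernel $(S,\Sigma,\mu)$ from $X$ to a separable metric space $S$ (with $\Sigma$ the Borel $\sigma$-algebra of $S$), and in which the morphisms are kernel morphisms. Then for every cospan $$(S_1,\Sigma_1,\mu_1)\xrightarrow{h_1}(S_0,\Sigma_0,\mu_0)\xleftarrow{h_2}(S_2,\Sigma_2,\mu_2)$$ in this category there is a semipullback $(S_3,\Sigma_3,\mu_3)$ in this category such that $S_3$ is the set pullback $$S_3=\{(x_1,x_2)\in S_1\times S_2 : h_1(x_1)=h_2(x_2)\}$$ of $S_1\xrightarrow{h_1}S_0\xleftarrow{h_2}S_2$ (with the maps $k_j\colon S_3\to S_j$, $j=1,2$, of the semipullback being the restrictions to $S_3$ of the coordinate projections). Moreover, $S_3$ is a measurable subset of $S_1\times S_2$, i.e. it belongs to the product $\sigma$-algebra of $\Sigma_1$ and $\Sigma_2$.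
   Context: Kernels. For measurable spaces $(X,\Xi)$ and $(S,\Sigma)$, a kernel from $X$ to $S$ is a map $\mu\colon X\times\Sigma\to[0,\infty)$, written $\mu^x(Q)=\mu(x,Q)$, such that $\mu^x$ is a (countably additive) measure on $\Sigma$ for each $x\in X$, and $x\mapsto\mu^x(Q)$ is $\Xi$-Borel measurable for each $Q\in\Sigma$. It is a subprobability kernel if $\mu^x(S)\le 1$ for all $x\in X$. It is a Radon subprobability kernel if moreover $S$ is a topological space, $\Sigma$ is its Borel $\sigma$-algebra, and every $\mu^x$ is a Radon measure. A Radon measure is a non-negative measure $\nu$ on the Borel $\sigma$-algebra of a topological space with $\nu(B)=\sup\{\nu(K): K\subseteq B,\ K\text{ compact}\}$ for every Borel set $B$. A kernel $\mu$ from $X$ to $S$ is also written $(S,\Sigma,\mu)$. Kernel morphisms. If $\mu_1,\mu_2$ are kernels from the same $X$ to $(S_1,\Sigma_1)$ and $(S_2,\Sigma_2)$ respectively, a kernel morphism from $\mu_1$ to $\mu_2$ is a map $h\colon S_1\to S_2$ that is $\Sigma_1$-$\Sigma_2$ measurable, surjective ($h(S_1)=S_2$), and satisfies $\mu_1^x(h^{-1}(A))=\mu_2^x(A)$ for all $x\in X$, $A\in\Sigma_2$. Semipullbacks. A cospan is a pair of morphisms $h_1\colon S_1\to S_0$, $h_2\colon S_2\to S_0$ with common codomain. A semipullback of it is an object $S_3$ together with morphisms $k_1\colon S_3\to S_1$, $k_2\colon S_3\to S_2$ of the category such that $h_1\circ k_1=h_2\circ k_2$ (no universal property is required). *)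

theory Defs
  imports "HOL-Analysis.Analysis"
begin

text \<open>A measurable space \<open>(S, \<Sigma>)\<close> is represented by any term of type \<open>'a measure\<close> with the right
  \<open>space\<close> and \<open>sets\<close>; its measure component is never used. Topological and metric spaces have
  explicit, possibly empty, carriers (types \<open>'a topology\<close> and \<open>'a metric\<close>).\<close>

definition borel_of :: "'a topology \<Rightarrow> 'a measure"
  where "borel_of T = sigma (topspace T) {U. openin T U}"

text \<open>The Giry space \<open>subprob_algebra\<close> is not used for subprobability kernels because it
  excludes kernels to an empty space.\<close>

definition kernel :: "'x measure \<Rightarrow> 'a measure \<Rightarrow> ('x \<Rightarrow> 'a measure) \<Rightarrow> bool"
  where "kernel X S \<mu> \<longleftrightarrow>
    (\<forall>x\<in>space X. sets (\<mu> x) = sets S \<and> finite_measure (\<mu> x)) \<and>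
    (\<forall>Q\<in>sets S. (\<lambda>x. measure (\<mu> x) Q) \<in> borel_measurable X)"

definition subprob_kernel :: "'x measure \<Rightarrow> 'a measure \<Rightarrow> ('x \<Rightarrow> 'a measure) \<Rightarrow> bool"
  where "subprob_kernel X S \<mu> \<longleftrightarrow>
    kernel X S \<mu> \<and> (\<forall>x\<in>space X. emeasure (\<mu> x) (space S) \<le> 1)"

text \<open>Compact sets that are not Borel (only possible in non-Hausdorff spaces) have \<open>emeasure\<close> 0
  and so do not affect the supremum.\<close>

definition radon_measure :: "'a topology \<Rightarrow> 'a measure \<Rightarrow> bool"
  where "radon_measure T \<nu> \<longleftrightarrow>
    sets \<nu> = sets (borel_of T) \<and>
    (\<forall>B\<in>sets (borel_of T). emeasure \<nu> B = (SUP K\<in>{K. K \<subseteq> B \<and> compactin T K}. emeasure \<nu> K))"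

definition radon_subprob_kernel :: "'x measure \<Rightarrow> 'a topology \<Rightarrow> ('x \<Rightarrow> 'a measure) \<Rightarrow> bool"
  where "radon_subprob_kernel X T \<mu> \<longleftrightarrow>
    subprob_kernel X (borel_of T) \<mu> \<and> (\<forall>x\<in>space X. radon_measure T (\<mu> x))"

definition kernel_morphism ::
    "'x measure \<Rightarrow> 'a measure \<Rightarrow> ('x \<Rightarrow> 'a measure) \<Rightarrow> 'b measure \<Rightarrow> ('x \<Rightarrow> 'b measure) \<Rightarrow> ('a \<Rightarrow> 'b) \<Rightarrow> bool"
  where "kernel_morphism X S1 \<mu>1 S2 \<mu>2 h \<longleftrightarrow>
    h \<in> measurable S1 S2 \<and>
    h ` space S1 = space S2 \<and>
    (\<forall>x\<in>space X. \<forall>A\<in>sets S2. emeasure (\<mu>1 x) (h -` A \<inter> space S1) = emeasure (\<mu>2 x) A)"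

text \<open>The category of Radon subprobability kernels from \<open>X\<close> to separable metric spaces.\<close>

abbreviation mborel :: "'a metric \<Rightarrow> 'a measure"
  where "mborel S \<equiv> borel_of (mtopology_of S)"

definition rk_object :: "'x measure \<Rightarrow> 'a metric \<Rightarrow> ('x \<Rightarrow> 'a measure) \<Rightarrow> bool"
  where "rk_object X S \<mu> \<longleftrightarrow>
    separable_space (mtopology_of S) \<and> radon_subprob_kernel X (mtopology_of S) \<mu>"

definition rk_morphism ::
    "'x measure \<Rightarrow> 'a metric \<Rightarrow> ('x \<Rightarrow> 'a measure) \<Rightarrow> 'b metric \<Rightarrow> ('x \<Rightarrow> 'b measure) \<Rightarrow> ('a \<Rightarrow> 'b) \<Rightarrow> bool"
  where "rk_morphism X S1 \<mu>1 S2 \<mu>2 h \<longleftrightarrow>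
    rk_object X S1 \<mu>1 \<and> rk_object X S2 \<mu>2 \<and>
    kernel_morphism X (mborel S1) \<mu>1 (mborel S2) \<mu>2 h"

definition rk_cospan ::
    "'x measure \<Rightarrow> 'a metric \<Rightarrow> ('x \<Rightarrow> 'a measure) \<Rightarrow> 'b metric \<Rightarrow> ('x \<Rightarrow> 'b measure) \<Rightarrow>
     'c metric \<Rightarrow> ('x \<Rightarrow> 'c measure) \<Rightarrow> ('a \<Rightarrow> 'c) \<Rightarrow> ('b \<Rightarrow> 'c) \<Rightarrow> bool"
  where "rk_cospan X S1 \<mu>1 S2 \<mu>2 S0 \<mu>0 h1 h2 \<longleftrightarrow>
    rk_morphism X S1 \<mu>1 S0 \<mu>0 h1 \<and> rk_morphism X S2 \<mu>2 S0 \<mu>0 h2"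

definition rk_semipullback ::
    "'x measure \<Rightarrow> 'a metric \<Rightarrow> ('x \<Rightarrow> 'a measure) \<Rightarrow> 'b metric \<Rightarrow> ('x \<Rightarrow> 'b measure) \<Rightarrow>
     ('a \<Rightarrow> 'c) \<Rightarrow> ('b \<Rightarrow> 'c) \<Rightarrow>
     'd metric \<Rightarrow> ('x \<Rightarrow> 'd measure) \<Rightarrow> ('d \<Rightarrow> 'a) \<Rightarrow> ('d \<Rightarrow> 'b) \<Rightarrow> bool"
  where "rk_semipullback X S1 \<mu>1 S2 \<mu>2 h1 h2 S3 \<mu>3 k1 k2 \<longleftrightarrow>
    rk_object X S3 \<mu>3 \<and>
    rk_morphism X S3 \<mu>3 S1 \<mu>1 k1 \<and>
    rk_morphism X S3 \<mu>3 S2 \<mu>2 k2 \<and>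
    (\<forall>s\<in>mspace S3. h1 (k1 s) = h2 (k2 s))"

definition set_pullback :: "'a set \<Rightarrow> 'b set \<Rightarrow> ('a \<Rightarrow> 'c) \<Rightarrow> ('b \<Rightarrow> 'c) \<Rightarrow> ('a \<times> 'b) set"
  where "set_pullback A B h1 h2 = {(a, b). a \<in> A \<and> b \<in> B \<and> h1 a = h2 b}"

text \<open>The set pullback as a metric subspace of the product, so that its topology is the
  subspace topology of the product topology.\<close>

definition metric_pullback :: "'a metric \<Rightarrow> 'b metric \<Rightarrow> ('a \<Rightarrow> 'c) \<Rightarrow> ('b \<Rightarrow> 'c) \<Rightarrow> ('a \<times> 'b) metric"
  where "metric_pullback S1 S2 h1 h2 =
    submetric (prod_metric S1 S2) (set_pullback (mspace S1) (mspace S2) h1 h2)"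

end

theory Submission
  imports Defs
begin

text \<open>Choose open sets \<open>U\<^sub>0, U\<^sub>1, \<dots>\<close> separating the points of \<open>S\<^sub>0\<close>, and let \<open>\<pi>\<^sub>n\<close> be the finite partition of
  \<open>S\<^sub>0\<close> that they generate up to \<open>n\<close>. For each \<open>x\<close>, the measures
  \<open>\<gamma>\<^sub>n(Z) = \<Sum>\<^bsub>P \<in> \<pi>\<^sub>n\<^esub> (\<mu>\<^sub>1 \<otimes> \<mu>\<^sub>2)(Z \<inter> h\<^sub>1\<^sup>-\<^sup>1 P \<times> h\<^sub>2\<^sup>-\<^sup>1 P) / \<mu>\<^sub>0(P)\<close>
  have marginals \<open>\<mu>\<^sub>1\<close> and \<open>\<mu>\<^sub>2\<close> and live on pairs whose images are in the same cell of \<open>\<pi>\<^sub>n\<close>. On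
  rectangles \<open>\<gamma>\<^sub>n\<close> converges, and the limit is measurable in \<open>x\<close> because each \<open>\<gamma>\<^sub>n\<close> is. Since both
  marginals are Radon, rectangles are approximated by compact rectangles from inside and open ones
  from outside, which makes the limit countably additive on rectangles; its Caratheodory extension is
  the conditional product of \<open>\<mu>\<^sub>1\<close> and \<open>\<mu>\<^sub>2\<close> over \<open>\<mu>\<^sub>0\<close>, and it is concentrated on the set pullback.\<close>

section \<open>Sums over refining partitions\<close>

text \<open>Refining by one more set replaces each index \<open>I\<close> by the pair
  \<open>I\<close>, \<open>insert n I\<close>, just as \<open>U n\<close> cuts each cell in
  two.\<close>

lemma sum_Pow_lessThan_Suc:
  fixes f :: "nat set \<Rightarrow> 'a::comm_monoid_add"
  shows "(\<Sum>I\<in>Pow {..<Suc n}. f I) = (\<Sum>I\<in>Pow {..<n}. f I + f (insert n I))"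
proof -
  have "(\<Sum>I\<in>insert n ` Pow {..<n}. f I) = (\<Sum>I\<in>Pow {..<n}. f (insert n I))"
    by (subst sum.reindex) (auto simp: inj_on_def)
  then show ?thesis
    by (subst lessThan_Suc, subst Pow_insert, subst sum.union_disjoint) (auto simp: sum.distrib)
qed

text \<open>Cauchy-Schwarz for two terms. The bounds by \<open>C * m\<close> and
  \<open>C * k\<close> force each numerator to vanish with its denominator, so the convention
  \<open>x / 0 = 0\<close> does no harm.\<close>

lemma square_div_subadditive:
  fixes a b m k C :: real
  assumes "m \<ge> 0" "k \<ge> 0" "\<bar>a\<bar> \<le> C * m" "\<bar>b\<bar> \<le> C * k"
  shows "(a + b)\<^sup>2 / (m + k) \<le> a\<^sup>2 / m + b\<^sup>2 / k"
proof (cases "m = 0 \<or> k = 0")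
  case True
  then show ?thesis using assms by auto
next
  case False
  with assms have mk: "m > 0" "k > 0" by auto
  have "a\<^sup>2 / m + b\<^sup>2 / k - (a + b)\<^sup>2 / (m + k) = (a * k - b * m)\<^sup>2 / (m * k * (m + k))"
    using mk by (simp add: field_simps power2_eq_square)
  also have "\<dots> \<ge> 0" using mk by simp
  finally show ?thesis by simp
qed

text \<open>The atoms of the algebra generated by the first \<open>n\<close> sets
  \<open>U i\<close>, indexed by membership pattern. Some patterns may give the empty set; sums over
  all patterns are still correct because additive set functions vanish there.\<close>

definition cell :: "'c set \<Rightarrow> (nat \<Rightarrow> 'c set) \<Rightarrow> nat \<Rightarrow> nat set \<Rightarrow> 'c set"
  where "cell \<Omega> U n I = {s \<in> \<Omega>. \<forall>i<n. s \<in> U i \<longleftrightarrow> i \<in> I}"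

lemma cell_0 [simp]: "cell \<Omega> U 0 I = \<Omega>"
  by (simp add: cell_def)

lemma cell_Suc:
  assumes "I \<subseteq> {..<n}"
  shows "cell \<Omega> U (Suc n) I = cell \<Omega> U n I - U n"
    and "cell \<Omega> U (Suc n) (insert n I) = cell \<Omega> U n I \<inter> U n"
  using assms by (auto simp: cell_def less_Suc_eq)

lemma cell_sets:
  assumes "\<And>i. U i \<in> sets M"
  shows "cell (space M) U n I \<in> sets M"
proof (induction n arbitrary: I)
  case (Suc n)
  have "cell (space M) U (Suc n) I =
      (if n \<in> I then cell (space M) U n I \<inter> U n else cell (space M) U n I - U n)"
    by (auto simp: cell_def less_Suc_eq)
  then show ?case using Suc assms by simp
qed simp

text \<open>Splitting every cell by \<open>U n\<close> leaves the sum unchanged. The additivity of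
  \<open>u\<close> is phrased as a splitting identity so that \<open>u D\<close> can be
  \<open>measure M0 D\<close> as well as the measure of the part of a fixed set that
  \<open>h1\<close> or \<open>h2\<close> sends into \<open>D\<close>.\<close>

lemma sum_cells:
  fixes u :: "'c set \<Rightarrow> real"
  assumes U: "\<And>i. U i \<in> sets M"
    and u: "\<And>P Q. P \<in> sets M \<Longrightarrow> Q \<in> sets M \<Longrightarrow> u P = u (P - Q) + u (P \<inter> Q)"
  shows "(\<Sum>I\<in>Pow {..<n}. u (cell (space M) U n I)) = u (space M)"
proof (induction n)
  case (Suc n)
  have "(\<Sum>I\<in>Pow {..<Suc n}. u (cell (space M) U (Suc n) I)) = (\<Sum>I\<in>Pow {..<n}. u (cell (space M) U n I))"
    unfolding sum_Pow_lessThan_Suc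
    by (intro sum.cong refl) (simp add: cell_Suc u[OF cell_sets[OF U] U[of n], symmetric])
  then show ?case using Suc by simp
qed simp

text \<open>By Cauchy-Schwarz the sums increase as the partition is refined.\<close>

lemma square_sums_convergent:
  fixes u m :: "'c set \<Rightarrow> real"
  assumes U: "\<And>i. U i \<in> sets M"
    and u: "\<And>P Q. P \<in> sets M \<Longrightarrow> Q \<in> sets M \<Longrightarrow> u P = u (P - Q) + u (P \<inter> Q)"
    and m: "\<And>P Q. P \<in> sets M \<Longrightarrow> Q \<in> sets M \<Longrightarrow> m P = m (P - Q) + m (P \<inter> Q)"
    and le: "\<And>P. P \<in> sets M \<Longrightarrow> \<bar>u P\<bar> \<le> C * m P"
    and m0: "\<And>P. P \<in> sets M \<Longrightarrow> 0 \<le> m P"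
  shows "convergent (\<lambda>n. \<Sum>I\<in>Pow {..<n}. (u (cell (space M) U n I))\<^sup>2 / m (cell (space M) U n I))"
    (is "convergent ?s")
proof -
  let ?c = "cell (space M) U"
  have inc: "incseq ?s"
  proof (rule incseq_SucI)
    fix n
    show "?s n \<le> ?s (Suc n)"
      unfolding sum_Pow_lessThan_Suc
    proof (intro sum_mono)
      fix I assume "I \<in> Pow {..<n}"
      then have I: "I \<subseteq> {..<n}" by auto
      have "?c n I - U n \<in> sets M" "?c n I \<inter> U n \<in> sets M"
        using cell_sets[OF U] U by auto
      then show "(u (?c n I))\<^sup>2 / m (?c n I) \<le> (u (?c (Suc n) I))\<^sup>2 / m (?c (Suc n) I) +
          (u (?c (Suc n) (insert n I)))\<^sup>2 / m (?c (Suc n) (insert n I))"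
        unfolding cell_Suc[OF I] u[OF cell_sets[OF U] U[of n]] m[OF cell_sets[OF U] U[of n]]
        by (intro square_div_subadditive[where C=C] m0 le)
    qed
  qed
  \<comment> \<open>Summed over the cells, this bounds every \<open>?s n\<close> by
    \<open>C\<^sup>2 * m (space M)\<close>, which does not depend on \<open>n\<close>.\<close>
  have "(u P)\<^sup>2 / m P \<le> C\<^sup>2 * m P" if "P \<in> sets M" for P
  proof (cases "m P = 0")
    case False
    with m0[OF that] have "m P > 0" by simp
    moreover have "(u P)\<^sup>2 \<le> (C * m P)\<^sup>2"
      using le[OF that] by (metis abs_ge_zero power2_abs power_mono)
    ultimately show ?thesis by (simp add: field_simps power2_eq_square)
  qed simp
  then have "?s n \<le> (\<Sum>I\<in>Pow {..<n}. C\<^sup>2 * m (?c n I))" for n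
    by (intro sum_mono) (simp add: cell_sets[OF U])
  moreover have "(\<Sum>I\<in>Pow {..<n}. C\<^sup>2 * m (?c n I)) = C\<^sup>2 * m (space M)" for n
    by (simp add: sum_distrib_left[symmetric] sum_cells[where u=m, OF U m])
  ultimately have "?s n \<le> C\<^sup>2 * m (space M)" for n
    by metis
  then obtain L where "?s \<longlonglongrightarrow> L"
    using incseq_convergent[OF inc] by blast
  then show ?thesis
    by (rule convergentI)
qed

text \<open>Polarization reduces this to sums of squares.\<close>

lemma product_sums_convergent:
  fixes u v m :: "'c set \<Rightarrow> real"
  assumes U: "\<And>i. U i \<in> sets M"
    and u: "\<And>P Q. P \<in> sets M \<Longrightarrow> Q \<in> sets M \<Longrightarrow> u P = u (P - Q) + u (P \<inter> Q)"
    and v: "\<And>P Q. P \<in> sets M \<Longrightarrow> Q \<in> sets M \<Longrightarrow> v P = v (P - Q) + v (P \<inter> Q)"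
    and m: "\<And>P Q. P \<in> sets M \<Longrightarrow> Q \<in> sets M \<Longrightarrow> m P = m (P - Q) + m (P \<inter> Q)"
    and le: "\<And>P. P \<in> sets M \<Longrightarrow> \<bar>u P\<bar> \<le> m P" "\<And>P. P \<in> sets M \<Longrightarrow> \<bar>v P\<bar> \<le> m P"
  shows "convergent (\<lambda>n. \<Sum>I\<in>Pow {..<n}.
      u (cell (space M) U n I) * v (cell (space M) U n I) / m (cell (space M) U n I))"
proof -
  let ?c = "cell (space M) U"
  have m0: "0 \<le> m P" if "P \<in> sets M" for P using le(1)[OF that] by linarith
  have "convergent (\<lambda>n. \<Sum>I\<in>Pow {..<n}. (u (?c n I) + v (?c n I))\<^sup>2 / m (?c n I))"
  proof (rule square_sums_convergent[where u="\<lambda>P. u P + v P" and C=2, OF U _ m _ m0])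
    show "\<bar>u P + v P\<bar> \<le> 2 * m P" if "P \<in> sets M" for P
      using le[OF that] by linarith
    show "u P + v P = u (P - Q) + v (P - Q) + (u (P \<inter> Q) + v (P \<inter> Q))"
      if "P \<in> sets M" "Q \<in> sets M" for P Q
      using u[OF that] v[OF that] by linarith
  qed
  moreover have "convergent (\<lambda>n. \<Sum>I\<in>Pow {..<n}. (u (?c n I) - v (?c n I))\<^sup>2 / m (?c n I))"
  proof (rule square_sums_convergent[where u="\<lambda>P. u P - v P" and C=2, OF U _ m _ m0])
    show "\<bar>u P - v P\<bar> \<le> 2 * m P" if "P \<in> sets M" for P
      using le[OF that] by linarith
    show "u P - v P = u (P - Q) - v (P - Q) + (u (P \<inter> Q) - v (P \<inter> Q))"
      if "P \<in> sets M" "Q \<in> sets M" for P Q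
      using u[OF that] v[OF that] by linarith
  qed
  ultimately have "convergent (\<lambda>n. 1/4 * ((\<Sum>I\<in>Pow {..<n}. (u (?c n I) + v (?c n I))\<^sup>2 / m (?c n I)) -
      (\<Sum>I\<in>Pow {..<n}. (u (?c n I) - v (?c n I))\<^sup>2 / m (?c n I))))"
    by (intro convergent_mult convergent_const convergent_diff)
  moreover have "1/4 * ((u P + v P)\<^sup>2 / m P - (u P - v P)\<^sup>2 / m P) = u P * v P / m P" for P
    by (simp add: power2_eq_square field_simps diff_divide_distrib[symmetric])
  ultimately show ?thesis
    by (simp add: sum_subtractf[symmetric] sum_distrib_left)
qed

section \<open>Borel \<open>\<sigma>\<close>-algebras and second countability\<close>

lemma space_borel_of [simp]: "space (borel_of T) = topspace T"
  and sets_borel_of: "sets (borel_of T) = sigma_sets (topspace T) {U. openin T U}"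
proof -
  have "{U. openin T U} \<subseteq> Pow (topspace T)" by (auto dest: openin_subset)
  then show "space (borel_of T) = topspace T"
      "sets (borel_of T) = sigma_sets (topspace T) {U. openin T U}"
    by (simp_all add: borel_of_def)
qed

lemma borel_of_open: "openin T U \<Longrightarrow> U \<in> sets (borel_of T)"
  by (simp add: sets_borel_of sigma_sets.Basic)

lemma borel_of_closed: "closedin T C \<Longrightarrow> C \<in> sets (borel_of T)"
  using sets.compl_sets[OF borel_of_open, of T "topspace T - C"]
  by (simp add: closedin_def double_diff)

lemma borel_of_compact: "Hausdorff_space T \<Longrightarrow> compactin T K \<Longrightarrow> K \<in> sets (borel_of T)"
  by (simp add: borel_of_closed compactin_imp_closedin)

text \<open>Open sets of the subspace are traces of open sets, and taking traces commutes with
  generating a \<sigma>-algebra. This identifies the Borel sets of the pullback with traces of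
  product-measurable sets.\<close>

lemma sets_borel_of_subtopology:
  assumes A: "A \<in> sets (borel_of T)"
  shows "sets (borel_of (subtopology T A)) = sets (restrict_space (borel_of T) A)"
proof -
  have "{U. openin (subtopology T A) U} = (\<inter>) A ` {U. openin T U}"
    by (auto simp: openin_subtopology)
  moreover have "A \<subseteq> topspace T" using sets.sets_into_space[OF A] by simp
  moreover from this have "topspace (subtopology T A) = A" by auto
  ultimately show ?thesis
    using sigma_sets_Int[OF A[unfolded sets_borel_of]]
    by (simp add: sets_borel_of[of "subtopology T A"] sets_restrict_space sets_borel_of[of T])
qed

lemma measurable_borel_of_continuous:
  assumes "continuous_map T T' f"
  shows "f \<in> borel_of T \<rightarrow>\<^sub>M borel_of T'"
proof (rule measurable_sigma_sets[OF sets_borel_of])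
  show "{U. openin T' U} \<subseteq> Pow (topspace T')" by (auto dest: openin_subset)
  show "f \<in> space (borel_of T) \<rightarrow> topspace T'"
    using assms by (simp add: continuous_map_def)
  show "f -` V \<inter> space (borel_of T) \<in> sets (borel_of T)" if "V \<in> {U. openin T' U}" for V
  proof -
    have "f -` V \<inter> space (borel_of T) = {x \<in> topspace T. f x \<in> V}" by auto
    with assms that show ?thesis by (auto intro!: borel_of_open simp: continuous_map_def)
  qed
qed

text \<open>Second countability makes every open set of the product a countable union of open
  rectangles, which gives the inclusion from left to right. The other inclusion is continuity of the
  projections.\<close>

lemma sets_borel_of_prod_topology:
  assumes "second_countable T1" "second_countable T2"
  shows "sets (borel_of (prod_topology T1 T2)) = sets (borel_of T1 \<Otimes>\<^sub>M borel_of T2)"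
proof
  obtain B1 where B1: "countable B1" "\<And>V. V \<in> B1 \<Longrightarrow> openin T1 V"
      "\<And>U x. openin T1 U \<Longrightarrow> x \<in> U \<Longrightarrow> \<exists>V\<in>B1. x \<in> V \<and> V \<subseteq> U"
    using assms(1) unfolding second_countable_def by metis
  obtain B2 where B2: "countable B2" "\<And>V. V \<in> B2 \<Longrightarrow> openin T2 V"
      "\<And>U x. openin T2 U \<Longrightarrow> x \<in> U \<Longrightarrow> \<exists>V\<in>B2. x \<in> V \<and> V \<subseteq> U"
    using assms(2) unfolding second_countable_def by metis
  have op: "W \<in> sets (borel_of T1 \<Otimes>\<^sub>M borel_of T2)" if W: "openin (prod_topology T1 T2) W" for W
  proof -
    define J where "J = {(a, b). a \<in> B1 \<and> b \<in> B2 \<and> a \<times> b \<subseteq> W}"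
    have "J \<subseteq> B1 \<times> B2" by (auto simp: J_def)
    with B1(1) B2(1) have "countable J" by (meson countable_SIGMA countable_subset)
    moreover have "W = (\<Union>(a, b)\<in>J. a \<times> b)"
    proof
      show "W \<subseteq> (\<Union>(a, b)\<in>J. a \<times> b)"
      proof
        fix z assume "z \<in> W"
        then obtain U V where "openin T1 U" "openin T2 V" "fst z \<in> U" "snd z \<in> V" "U \<times> V \<subseteq> W"
          using W unfolding openin_prod_topology_alt by (metis prod.collapse)
        moreover from this obtain a b where "a \<in> B1" "fst z \<in> a" "a \<subseteq> U" "b \<in> B2" "snd z \<in> b" "b \<subseteq> V"
          using B1(3) B2(3) by metis
        ultimately have "(a, b) \<in> J" "z \<in> a \<times> b" by (auto simp: J_def mem_Times_iff)
        then show "z \<in> (\<Union>(a, b)\<in>J. a \<times> b)" by blast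
      qed
    qed (auto simp: J_def)
    moreover have "(\<lambda>(a, b). a \<times> b) z \<in> sets (borel_of T1 \<Otimes>\<^sub>M borel_of T2)" if "z \<in> J" for z
      using that by (auto simp: J_def intro!: pair_measureI borel_of_open B1(2) B2(2))
    ultimately show ?thesis
      by (simp only: sets.countable_UN'')
  qed
  show "sets (borel_of (prod_topology T1 T2)) \<subseteq> sets (borel_of T1 \<Otimes>\<^sub>M borel_of T2)"
    unfolding sets_borel_of[of "prod_topology T1 T2"]
    using sets.sigma_sets_subset[of "{U. openin (prod_topology T1 T2) U}" "borel_of T1 \<Otimes>\<^sub>M borel_of T2"] op
    by (auto simp: space_pair_measure)
  show "sets (borel_of T1 \<Otimes>\<^sub>M borel_of T2) \<subseteq> sets (borel_of (prod_topology T1 T2))"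
  proof (rule sets_pair_in_sets)
    fix a b assume ab: "a \<in> sets (borel_of T1)" "b \<in> sets (borel_of T2)"
    let ?P = "borel_of (prod_topology T1 T2)"
    have "a \<times> b = (fst -` a \<inter> space ?P) \<inter> (snd -` b \<inter> space ?P)"
      using sets.sets_into_space[OF ab(1)] sets.sets_into_space[OF ab(2)] by auto
    also have "\<dots> \<in> sets ?P"
      by (rule sets.Int[OF measurable_sets[OF measurable_borel_of_continuous[OF continuous_map_fst] ab(1)]
            measurable_sets[OF measurable_borel_of_continuous[OF continuous_map_snd] ab(2)]])
    finally show "a \<times> b \<in> sets ?P" .
  qed
qed

section \<open>Countable bases of separable metric spaces and of products\<close>

lemma Hausdorff_space_mtopology_of: "Hausdorff_space (mtopology_of S)"
  by (simp add: mtopology_of_def Metric_space.Hausdorff_space_mtopology)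

text \<open>Balls of rational radius around the points of a countable dense set form a base.\<close>

lemma second_countable_mtopology_of:
  assumes "separable_space (mtopology_of S)"
  shows "second_countable (mtopology_of S)"
proof -
  interpret Metric_space "mspace S" "mdist S" by simp
  obtain C where C: "countable C" "C \<subseteq> mspace S" "mtopology closure_of C = mspace S"
    using assms by (auto simp: separable_space_def mtopology_of_def)
  define B where "B = (\<lambda>(c, r). mball c r) ` (C \<times> \<rat>)"
  have "countable B" using C(1) by (auto simp: B_def countable_rat)
  moreover have "\<forall>V\<in>B. openin mtopology V" by (auto simp: B_def)
  moreover have "\<exists>V\<in>B. x \<in> V \<and> V \<subseteq> U" if xU: "openin mtopology U" "x \<in> U" for U x
  proof -
    obtain e where e: "e > 0" "mball x e \<subseteq> U" "x \<in> mspace S"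
    proof -
      have "x \<in> mspace S" "\<exists>e>0. mball x e \<subseteq> U"
        using xU unfolding openin_mtopology by blast+
      then show thesis using that by blast
    qed
    \<comment> \<open>By the triangle inequality, a ball of radius \<open>r\<close> that contains
      \<open>x\<close> lies within distance \<open>2 * r\<close> of \<open>x\<close>; hence half of
      \<open>e\<close>.\<close>
    obtain r where r: "r \<in> \<rat>" "0 < r" "r < e / 2"
      using Rats_dense_in_real[of 0 "e/2"] half_gt_zero[OF e(1)] by blast
    have "x \<in> mtopology closure_of C" using C(3) e(3) by simp
    then obtain c where c: "c \<in> C" "c \<in> mball x r"
      using r(2) unfolding metric_closure_of by blast
    have "mball c r \<subseteq> mball x e"
      using c r by (intro mball_subset) (simp_all add: commute[of c x])
    then have "x \<in> mball c r" "mball c r \<subseteq> U"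
      using c(2) e(2) by (auto simp: commute[of c x])
    moreover have "mball c r \<in> B" using c(1) r(1) by (force simp: B_def)
    ultimately show ?thesis by blast
  qed
  ultimately show ?thesis
    unfolding second_countable_def mtopology_of_def by (intro exI[of _ B]) simp
qed

lemma second_countable_prod_topology:
  assumes "second_countable T1" "second_countable T2"
  shows "second_countable (prod_topology T1 T2)"
proof -
  obtain B1 where B1: "countable B1" "\<And>V. V \<in> B1 \<Longrightarrow> openin T1 V"
      "\<And>U x. openin T1 U \<Longrightarrow> x \<in> U \<Longrightarrow> \<exists>V\<in>B1. x \<in> V \<and> V \<subseteq> U"
    using assms(1) unfolding second_countable_def by metis
  obtain B2 where B2: "countable B2" "\<And>V. V \<in> B2 \<Longrightarrow> openin T2 V"
      "\<And>U x. openin T2 U \<Longrightarrow> x \<in> U \<Longrightarrow> \<exists>V\<in>B2. x \<in> V \<and> V \<subseteq> U"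
    using assms(2) unfolding second_countable_def by metis
  let ?B = "(\<lambda>(a, b). a \<times> b) ` (B1 \<times> B2)"
  have "countable ?B" using B1(1) B2(1) by auto
  moreover have "\<forall>V\<in>?B. openin (prod_topology T1 T2) V"
    using B1(2) B2(2) by (auto simp: openin_prod_Times_iff)
  moreover have "\<exists>V\<in>?B. z \<in> V \<and> V \<subseteq> W" if W: "openin (prod_topology T1 T2) W" "z \<in> W" for W z
  proof -
    obtain U V where "openin T1 U" "openin T2 V" "fst z \<in> U" "snd z \<in> V" "U \<times> V \<subseteq> W"
      using W unfolding openin_prod_topology_alt by (metis prod.collapse)
    moreover from this obtain a b where ab: "a \<in> B1" "fst z \<in> a" "a \<subseteq> U" "b \<in> B2" "snd z \<in> b" "b \<subseteq> V"
      using B1(3) B2(3) by metis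
    ultimately have "z \<in> a \<times> b" "a \<times> b \<subseteq> W" by (auto simp: mem_Times_iff)
    with ab show ?thesis by force
  qed
  ultimately show ?thesis unfolding second_countable_def by (intro exI[of _ ?B]) simp
qed

text \<open>The members of a countable base do this: by the Hausdorff property one of them contains
  \<open>a\<close> and misses \<open>b\<close>. Countably many sets then detect whether two points
  of the base space differ.\<close>

lemma separating_open_sequence:
  assumes "second_countable T" "Hausdorff_space T"
  shows "\<exists>U :: nat \<Rightarrow> 'a set. (\<forall>i. openin T (U i)) \<and>
    (\<forall>a\<in>topspace T. \<forall>b\<in>topspace T. (\<forall>i. a \<in> U i \<longleftrightarrow> b \<in> U i) \<longrightarrow> a = b)"
proof -
  obtain B where B: "countable B" "\<And>V. V \<in> B \<Longrightarrow> openin T V"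
      "\<And>U x. openin T U \<Longrightarrow> x \<in> U \<Longrightarrow> \<exists>V\<in>B. x \<in> V \<and> V \<subseteq> U"
    using assms(1) unfolding second_countable_def by metis
  \<comment> \<open>The extra \<open>{}\<close> makes the enumerated set nonempty, as
    \<open>range_from_nat_into\<close> requires; the base itself may be empty when the space
    is.\<close>
  define U where "U = from_nat_into (insert {} B)"
  have rU: "range U = insert {} B"
    unfolding U_def using B(1) by (intro range_from_nat_into) auto
  show ?thesis
  proof (intro exI[of _ U] conjI allI ballI impI)
    show "openin T (U i)" for i
      using rU B(2) by (metis insertE openin_empty rangeI)
    fix a b assume ab: "a \<in> topspace T" "b \<in> topspace T" and eq: "\<forall>i. a \<in> U i \<longleftrightarrow> b \<in> U i"
    show "a = b"
    proof (rule ccontr)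
      assume "a \<noteq> b"
      then obtain V W where V: "openin T V" "a \<in> V" "b \<in> W" "disjnt V W"
        using assms(2) ab unfolding Hausdorff_space_def by metis
      obtain V' where V': "V' \<in> B" "a \<in> V'" "V' \<subseteq> V" using B(3)[OF V(1,2)] by auto
      obtain i where "V' = U i" using rU V'(1) by (metis imageE insertCI)
      with V' V eq show False by (auto simp: disjnt_iff)
    qed
  qed
qed

section \<open>Finite Radon measures\<close>

text \<open>Inner regularity in \<epsilon>-form. For finite measures on Hausdorff spaces it is
  equivalent to \<open>radon_measure\<close>, and errors stated as real numbers are easier to add up
  than suprema in \<open>ennreal\<close>.\<close>

definition finite_radon_measure :: "'a topology \<Rightarrow> 'a measure \<Rightarrow> bool"
  where "finite_radon_measure T M \<longleftrightarrow> finite_measure M \<and> sets M = sets (borel_of T) \<and>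
    (\<forall>A\<in>sets M. \<forall>e>0. \<exists>K\<subseteq>A. compactin T K \<and> measure M (A - K) < e)"

text \<open>Inner regularity applied to the complement of \<open>A\<close>: a compact
  \<open>K\<close> found there is closed by the Hausdorff property, so removing it from the space
  leaves an open set around \<open>A\<close>.\<close>

lemma finite_radon_outer:
  assumes "Hausdorff_space T" and M: "finite_radon_measure T M" and A: "A \<in> sets M" and "e > 0"
  obtains V where "openin T V" "A \<subseteq> V" "measure M (V - A) < e"
proof -
  have sM: "sets M = sets (borel_of T)" using M by (simp add: finite_radon_measure_def)
  then have sp: "space M = topspace T" by (metis sets_eq_imp_space_eq space_borel_of)
  obtain K where K: "K \<subseteq> space M - A" "compactin T K" "measure M (space M - A - K) < e"
    using M sets.compl_sets[OF A] \<open>e > 0\<close> unfolding finite_radon_measure_def by blast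
  show thesis
  proof
    show "openin T (topspace T - K)"
      using compactin_imp_closedin[OF assms(1) K(2)] by blast
    show "A \<subseteq> topspace T - K" using K(1) sets.sets_into_space[OF A] sp by auto
    have "topspace T - K - A = space M - A - K" using sp by auto
    then show "measure M (topspace T - K - A) < e" using K(3) by simp
  qed
qed

lemma radon_imp_finite_radon:
  assumes H: "Hausdorff_space T" and M: "finite_measure M" "radon_measure T M"
  shows "finite_radon_measure T M"
  unfolding finite_radon_measure_def
proof (intro conjI ballI allI impI)
  interpret finite_measure M by fact
  show sM: "sets M = sets (borel_of T)" using M(2) by (simp add: radon_measure_def)
  fix A and e :: real assume A: "A \<in> sets M" and e: "e > 0"
  show "\<exists>K\<subseteq>A. compactin T K \<and> measure M (A - K) < e"
  \<comment> \<open>In the first case the empty compact set suffices. In the second,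
    \<open>measure M A - e\<close> is nonnegative and survives the passage to \<open>ennreal\<close>
    without truncation.\<close>
  proof (cases "measure M A < e")
    case True
    then show ?thesis by (intro exI[of _ "{}"]) simp
  next
    case False
    have "ennreal (measure M A - e) < ennreal (measure M A)"
      using False e by (intro ennreal_lessI) linarith+
    also have "\<dots> = (SUP K\<in>{K. K \<subseteq> A \<and> compactin T K}. emeasure M K)"
      using M(2) A sM unfolding radon_measure_def by (simp add: emeasure_eq_measure[symmetric])
    finally obtain K where K: "K \<subseteq> A" "compactin T K" "ennreal (measure M A - e) < emeasure M K"
      unfolding less_SUP_iff by blast
    have "measure M A - e < measure M K"
      using K(3) False by (simp add: emeasure_eq_measure ennreal_less_iff)
    moreover have "K \<in> sets M" using borel_of_compact[OF H K(2)] sM by simp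
    ultimately show ?thesis using K(1,2) A by (intro exI[of _ K]) (simp add: finite_measure_Diff)
  qed
qed (rule M(1))

lemma finite_radon_imp_radon:
  assumes H: "Hausdorff_space T" and M: "finite_radon_measure T M"
  shows "radon_measure T M"
proof -
  interpret finite_measure M using M by (simp add: finite_radon_measure_def)
  have sM: "sets M = sets (borel_of T)" using M by (simp add: finite_radon_measure_def)
  have "emeasure M B = (SUP K\<in>{K. K \<subseteq> B \<and> compactin T K}. emeasure M K)" (is "_ = ?S")
    if B: "B \<in> sets M" for B
  proof (rule antisym)
    show "?S \<le> emeasure M B" using B by (intro SUP_least emeasure_mono) auto
    show "emeasure M B \<le> ?S"
    proof (rule ennreal_le_epsilon)
      fix e :: real assume "0 < e"
      then obtain K where K: "K \<subseteq> B" "compactin T K" "measure M (B - K) < e"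
        using M B unfolding finite_radon_measure_def by blast
      have Ks: "K \<in> sets M" using borel_of_compact[OF H K(2)] sM by simp
      have "measure M B \<le> measure M K + e"
        using K(3) finite_measure_Diff[OF B Ks K(1)] by linarith
      then have "emeasure M B \<le> emeasure M K + ennreal e"
        using \<open>0 < e\<close> by (simp add: emeasure_eq_measure ennreal_plus[symmetric] del: ennreal_plus)
      also have "\<dots> \<le> ?S + ennreal e"
        using K by (intro add_right_mono SUP_upper) simp
      finally show "emeasure M B \<le> ?S + ennreal e" .
    qed
  qed
  then show ?thesis by (simp add: radon_measure_def sM)
qed

lemma finite_radon_restrict:
  assumes M: "finite_radon_measure T M" and S: "S \<in> sets M"
  shows "finite_radon_measure (subtopology T S) (restrict_space M S)"
  unfolding finite_radon_measure_def
proof (intro conjI ballI allI impI)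
  have sM: "sets M = sets (borel_of T)" using M by (simp add: finite_radon_measure_def)
  show "finite_measure (restrict_space M S)"
    using M S by (simp add: finite_radon_measure_def finite_measure_restrict_space)
  show "sets (restrict_space M S) = sets (borel_of (subtopology T S))"
    using sets_borel_of_subtopology[of S T] S sM by (simp cong: sets_restrict_space_cong)
  fix A and e :: real assume A: "A \<in> sets (restrict_space M S)" and "e > 0"
  then have A': "A \<in> sets M" "A \<subseteq> S" using S by (auto simp: sets_restrict_space_iff)
  then obtain K where "K \<subseteq> A" "compactin T K" "measure M (A - K) < e"
    using M \<open>e > 0\<close> unfolding finite_radon_measure_def by blast
  moreover have "measure (restrict_space M S) (A - K) = measure M (A - K)"
    using A' S by (intro measure_restrict_space) auto
  ultimately show "\<exists>K\<subseteq>A. compactin (subtopology T S) K \<and> measure (restrict_space M S) (A - K) < e"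
    using A' by (intro exI[of _ K]) (auto simp: compactin_subtopology)
qed

text \<open>Every coupling \<open>N\<close> of two finite Radon measures is Radon. For a rectangle,
  the part missed by a product of compact sets is at most the sum of the two marginal errors; from
  there inner approximation passes to countable unions and intersections.\<close>

lemma finite_radon_pair:
  assumes T: "Hausdorff_space T1" "Hausdorff_space T2" "second_countable T1" "second_countable T2"
    and R: "finite_radon_measure T1 M1" "finite_radon_measure T2 M2"
    and N: "finite_measure N" "sets N = sets (M1 \<Otimes>\<^sub>M M2)"
    and marg1: "\<And>A. A \<in> sets M1 \<Longrightarrow> measure N (A \<times> space M2) = measure M1 A"
    and marg2: "\<And>B. B \<in> sets M2 \<Longrightarrow> measure N (space M1 \<times> B) = measure M2 B"
  shows "finite_radon_measure (prod_topology T1 T2) N"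
proof -
  interpret N: finite_measure N by fact
  let ?T = "prod_topology T1 T2"
  have s1: "sets M1 = sets (borel_of T1)" and s2: "sets M2 = sets (borel_of T2)"
    using R by (auto simp: finite_radon_measure_def)
  have sN: "sets N = sets (borel_of ?T)"
    using N(2) sets_borel_of_prod_topology[OF T(3,4)] sets_pair_measure_cong[OF s1 s2] by simp
  have spN: "space N = space M1 \<times> space M2"
    using sets_eq_imp_space_eq[OF N(2)] by (simp add: space_pair_measure)
  have HT: "Hausdorff_space ?T" using T by (simp add: Hausdorff_space_prod_topology)
  \<comment> \<open>The sets that are good together with their complement form a \<open>\<sigma>\<close>-algebra.\<close>
  define good where "good Z \<longleftrightarrow> Z \<in> sets N \<and> (\<forall>e>0. \<exists>K\<subseteq>Z. compactin ?T K \<and> measure N (Z - K) < e)" for Z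
  have cs: "compactin ?T K \<Longrightarrow> K \<in> sets N" for K
    by (simp add: sN borel_of_compact HT)
  have gTimes: "good (A \<times> B)" if A: "A \<in> sets M1" and B: "B \<in> sets M2" for A B
    unfolding good_def
  proof (intro conjI allI impI)
    show "A \<times> B \<in> sets N" using A B N(2) by simp
    fix e :: real assume "e > 0"
    then have e: "e / 2 > 0" by simp
    obtain K where K: "K \<subseteq> A" "compactin T1 K" "measure M1 (A - K) < e/2"
      using R(1) A e unfolding finite_radon_measure_def by blast
    obtain L where L: "L \<subseteq> B" "compactin T2 L" "measure M2 (B - L) < e/2"
      using R(2) B e unfolding finite_radon_measure_def by blast
    have KL: "K \<in> sets M1" "L \<in> sets M2"
      using borel_of_compact T K L s1 s2 by auto
    have "measure N (A \<times> B - K \<times> L) \<le> measure N ((A - K) \<times> space M2 \<union> space M1 \<times> (B - L))"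
      using A B KL sets.sets_into_space[OF A] sets.sets_into_space[OF B]
      by (intro N.finite_measure_mono) (auto simp: N(2))
    also have "\<dots> \<le> measure N ((A - K) \<times> space M2) + measure N (space M1 \<times> (B - L))"
      using A B KL by (intro measure_Un_le) (auto simp: N(2))
    also have "\<dots> < e" using A B KL K(3) L(3) by (simp add: marg1 marg2)
    finally show "\<exists>Q\<subseteq>A \<times> B. compactin ?T Q \<and> measure N (A \<times> B - Q) < e"
      using K L by (intro exI[of _ "K \<times> L"]) (auto simp: compactin_Times)
  qed
  have gUn: "good (\<Union>i. Z i)" if g: "\<And>i::nat. good (Z i)" for Z
    unfolding good_def
  proof (intro conjI allI impI)
    have Zs: "Z i \<in> sets N" for i using g by (simp add: good_def)
    then show "(\<Union>i. Z i) \<in> sets N" by auto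
    fix e :: real assume e: "e > 0"
    have "e/2 * (1/2)^Suc i > 0" for i using e by simp
    then have "\<exists>K\<subseteq>Z i. compactin ?T K \<and> measure N (Z i - K) < e/2 * (1/2)^Suc i" for i
      using g[of i] unfolding good_def by blast
    then obtain K where K: "\<And>i. K i \<subseteq> Z i" "\<And>i. compactin ?T (K i)"
        "\<And>i. measure N (Z i - K i) < e/2 * (1/2)^Suc i" by metis
    have Ks: "K i \<in> sets N" for i using cs K(2) by simp
    \<comment> \<open>An infinite union of compact sets need not be compact, so the union is cut off
      at some \<open>n\<close> at a cost below \<open>e/2\<close>. The other \<open>e/2\<close> pays
      for approximating the individual \<open>Z i\<close>.\<close>
    have "(\<lambda>n. measure N (\<Union>i\<le>n. Z i)) \<longlonglongrightarrow> measure N (\<Union>n. \<Union>i\<le>n. Z i)"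
      using Zs by (intro N.finite_Lim_measure_incseq) (auto simp: incseq_def intro: order_trans)
    moreover have "(\<Union>n. \<Union>i\<le>n. Z i) = (\<Union>i. Z i)" by auto
    ultimately have "(\<lambda>n. measure N (\<Union>i\<le>n. Z i)) \<longlonglongrightarrow> measure N (\<Union>i. Z i)" by simp
    from LIMSEQ_D[OF this, of "e/2"] e obtain n
      where "norm (measure N (\<Union>i\<le>n. Z i) - measure N (\<Union>i. Z i)) < e/2" by auto
    then have n: "measure N (\<Union>i. Z i) - measure N (\<Union>i\<le>n. Z i) < e/2"
      by (simp add: abs_if split: if_splits)
    let ?K = "\<Union>i\<le>n. K i"
    have "measure N ((\<Union>i. Z i) - ?K) \<le> measure N (((\<Union>i. Z i) - (\<Union>i\<le>n. Z i)) \<union> (\<Union>i\<le>n. Z i - K i))"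
      using Zs Ks by (intro N.finite_measure_mono) auto
    also have "\<dots> \<le> measure N ((\<Union>i. Z i) - (\<Union>i\<le>n. Z i)) + measure N (\<Union>i\<le>n. Z i - K i)"
      using Zs Ks by (intro measure_Un_le) auto
    also have "measure N ((\<Union>i. Z i) - (\<Union>i\<le>n. Z i)) = measure N (\<Union>i. Z i) - measure N (\<Union>i\<le>n. Z i)"
      using Zs by (intro N.finite_measure_Diff) auto
    also have "measure N (\<Union>i\<le>n. Z i - K i) \<le> (\<Sum>i\<le>n. measure N (Z i - K i))"
      using Zs Ks by (intro measure_UNION_le) auto
    also have "\<dots> \<le> (\<Sum>i\<le>n. e/2 * (1/2)^Suc i)"
      by (intro sum_mono less_imp_le K(3))
    also have "\<dots> \<le> e/2 * (\<Sum>i. (1/2)^Suc i)"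
      unfolding sum_distrib_left[symmetric]
      using e sum_le_suminf[OF sums_summable[OF power_half_series], of "{..n}"]
      by (intro mult_left_mono) simp_all
    also have "\<dots> = e/2" using sums_unique[OF power_half_series] by simp
    finally have "measure N ((\<Union>i. Z i) - ?K) < e" using n by simp
    moreover have "compactin ?T ?K" using K(2) by (intro compactin_Union[of "K ` {..n}"]) auto
    moreover have "?K \<subseteq> (\<Union>i. Z i)" using K(1) by auto
    ultimately show "\<exists>Q\<subseteq>\<Union>i. Z i. compactin ?T Q \<and> measure N ((\<Union>i. Z i) - Q) < e" by blast
  qed
  have gInt: "good (\<Inter>i. Z i)" if g: "\<And>i::nat. good (Z i)" for Z
    unfolding good_def
  proof (intro conjI allI impI)
    have Zs: "Z i \<in> sets N" for i using g by (simp add: good_def)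
    then show "(\<Inter>i. Z i) \<in> sets N" by auto
    fix e :: real assume e: "e > 0"
    have "e/2 * (1/2)^Suc i > 0" for i using e by simp
    then have "\<exists>K\<subseteq>Z i. compactin ?T K \<and> measure N (Z i - K) < e/2 * (1/2)^Suc i" for i
      using g[of i] unfolding good_def by blast
    then obtain K where K: "\<And>i. K i \<subseteq> Z i" "\<And>i. compactin ?T (K i)"
        "\<And>i. measure N (Z i - K i) < e/2 * (1/2)^Suc i" by metis
    have Ks: "K i \<in> sets N" for i using cs K(2) by simp
    have su: "summable (\<lambda>i. e/2 * (1/2)^Suc i)"
      by (intro summable_mult sums_summable[OF power_half_series])
    have sm: "summable (\<lambda>i. measure N (Z i - K i))"
      using K(3) by (intro summable_comparison_test'[OF su, of 0]) (simp add: less_imp_le)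
    have "measure N ((\<Inter>i. Z i) - (\<Inter>i. K i)) \<le> measure N (\<Union>i. Z i - K i)"
      using Zs Ks by (intro N.finite_measure_mono) auto
    also have "\<dots> \<le> (\<Sum>i. measure N (Z i - K i))"
      using Zs Ks by (intro N.finite_measure_subadditive_countably sm) auto
    also have "\<dots> \<le> (\<Sum>i. e/2 * (1/2)^Suc i)"
      by (intro suminf_le less_imp_le K(3) sm su)
    also have "\<dots> = e/2 * (\<Sum>i. (1/2)^Suc i)"
      by (intro suminf_mult sums_summable[OF power_half_series])
    also have "\<dots> = e/2" using sums_unique[OF power_half_series] by simp
    finally have "measure N ((\<Inter>i. Z i) - (\<Inter>i. K i)) < e" using e by simp
    \<comment> \<open>Intersections need no cut-off: this is a closed subset of the compact set
      \<open>K 0\<close>.\<close>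
    moreover have "compactin ?T (\<Inter>i. K i)"
    proof (rule closed_compactin[OF K(2)[of 0]])
      show "closedin ?T (\<Inter>i. K i)" by (intro closedin_INT compactin_imp_closedin HT K(2)) auto
    qed auto
    moreover have "(\<Inter>i. K i) \<subseteq> (\<Inter>i. Z i)" using K(1) by blast
    ultimately show "\<exists>Q\<subseteq>\<Inter>i. Z i. compactin ?T Q \<and> measure N ((\<Inter>i. Z i) - Q) < e" by blast
  qed
  have "good Z \<and> good (space N - Z)" if "Z \<in> sets N" for Z
    using that unfolding N(2) sets_pair_measure
  proof (induction rule: sigma_sets.induct)
    case (Basic Z)
    then obtain A B where Z: "Z = A \<times> B" and A: "A \<in> sets M1" and B: "B \<in> sets M2" by auto
    \<comment> \<open>The complement of a rectangle is the union of two rectangles, written as a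
      sequence because \<open>gUn\<close> takes families indexed by \<open>nat\<close>.\<close>
    define F where "F = (\<lambda>i::nat. if i = 0 then (space M1 - A) \<times> space M2 else space M1 \<times> (space M2 - B))"
    have "good (\<Union>i. F i)" using A B by (intro gUn) (auto simp: F_def intro!: gTimes)
    moreover have "(\<Union>i. F i) = space N - Z"
    proof
      show "space N - Z \<subseteq> (\<Union>i. F i)"
      proof
        fix z assume "z \<in> space N - Z"
        then have "z \<in> F 0 \<or> z \<in> F 1" by (auto simp: F_def spN Z)
        then show "z \<in> (\<Union>i. F i)" by blast
      qed
    qed (auto simp: F_def spN Z split: if_splits)
    ultimately show ?case using gTimes[OF A B] by (simp add: Z)
  next
    case Empty
    show ?case using gTimes[of "{}" "{}"] gTimes[OF sets.top sets.top] by (simp add: spN)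
  next
    case (Compl Z)
    then have "Z \<subseteq> space N" by (auto simp: good_def dest: sets.sets_into_space)
    then show ?case using Compl by (simp add: spN[symmetric] double_diff)
  next
    case (Union Z)
    have "space N - (\<Union>i. Z i) = (\<Inter>i. space N - Z i)" by auto
    moreover have "good (\<Union>i. Z i)" "good (\<Inter>i. space N - Z i)"
      using Union.IH by (simp_all only: gUn gInt)
    ultimately show ?case by (simp only: simp_thms)
  qed
  then show ?thesis
    unfolding finite_radon_measure_def using N(1) sN good_def by auto
qed

section \<open>The conditional product\<close>

definition fiber_box :: "'a measure \<Rightarrow> 'b measure \<Rightarrow> 'c measure \<Rightarrow> ('a \<Rightarrow> 'c) \<Rightarrow> ('b \<Rightarrow> 'c) \<Rightarrow>
    (nat \<Rightarrow> 'c set) \<Rightarrow> nat \<Rightarrow> nat set \<Rightarrow> ('a \<times> 'b) set"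
  where "fiber_box M1 M2 M0 h1 h2 U n I =
    (h1 -` cell (space M0) U n I \<inter> space M1) \<times> (h2 -` cell (space M0) U n I \<inter> space M2)"

text \<open>Cells of measure 0 contribute 0 because \<open>x / 0 = 0\<close>; this loses no mass, as the marginals show.\<close>

definition fiber_approx :: "'a measure \<Rightarrow> 'b measure \<Rightarrow> 'c measure \<Rightarrow> ('a \<Rightarrow> 'c) \<Rightarrow> ('b \<Rightarrow> 'c) \<Rightarrow>
    (nat \<Rightarrow> 'c set) \<Rightarrow> nat \<Rightarrow> ('a \<times> 'b) set \<Rightarrow> real"
  where "fiber_approx M1 M2 M0 h1 h2 U n Z =
    (\<Sum>I\<in>Pow {..<n}. measure (M1 \<Otimes>\<^sub>M M2) (Z \<inter> fiber_box M1 M2 M0 h1 h2 U n I) /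
      measure M0 (cell (space M0) U n I))"

text \<open>\<open>lim\<close> has some value for every sequence. Convergence is established for
  rectangles, and it is only there that this value is used; all other sets are reached through the
  Caratheodory extension.\<close>

definition fiber_lim :: "'a measure \<Rightarrow> 'b measure \<Rightarrow> 'c measure \<Rightarrow> ('a \<Rightarrow> 'c) \<Rightarrow> ('b \<Rightarrow> 'c) \<Rightarrow>
    (nat \<Rightarrow> 'c set) \<Rightarrow> ('a \<times> 'b) set \<Rightarrow> real"
  where "fiber_lim M1 M2 M0 h1 h2 U Z = lim (\<lambda>n. fiber_approx M1 M2 M0 h1 h2 U n Z)"

text \<open>The data at a single point of \<open>X\<close>: \<open>h1\<close> and \<open>h2\<close>
  carry \<open>M1\<close> and \<open>M2\<close> to the common image \<open>M0\<close>, which is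
  compared along the partitions generated by \<open>U\<close>.\<close>

locale fiber_coupling =
  M1: finite_measure M1 + M2: finite_measure M2 + M0: finite_measure M0
  for M1 :: "'a measure" and M2 :: "'b measure" and M0 :: "'c measure" +
  fixes h1 :: "'a \<Rightarrow> 'c" and h2 :: "'b \<Rightarrow> 'c" and U :: "nat \<Rightarrow> 'c set"
  assumes h1 [measurable]: "h1 \<in> M1 \<rightarrow>\<^sub>M M0" and h2 [measurable]: "h2 \<in> M2 \<rightarrow>\<^sub>M M0"
    and push1: "\<And>A. A \<in> sets M0 \<Longrightarrow> measure M1 (h1 -` A \<inter> space M1) = measure M0 A"
    and push2: "\<And>A. A \<in> sets M0 \<Longrightarrow> measure M2 (h2 -` A \<inter> space M2) = measure M0 A"
    and U [measurable]: "\<And>i. U i \<in> sets M0"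
begin

abbreviation "C \<equiv> cell (space M0) U"
abbreviation "approx \<equiv> fiber_approx M1 M2 M0 h1 h2 U"
abbreviation "\<gamma> \<equiv> fiber_lim M1 M2 M0 h1 h2 U"

sublocale P: finite_measure "M1 \<Otimes>\<^sub>M M2"
  by (intro finite_measure_pair_measure) unfold_locales

lemma cell_measurable [measurable]: "C n I \<in> sets M0"
  by (intro cell_sets U)

lemma fiber_box_measurable [measurable]: "fiber_box M1 M2 M0 h1 h2 U n I \<in> sets (M1 \<Otimes>\<^sub>M M2)"
  unfolding fiber_box_def by (intro pair_measureI measurable_sets[OF h1] measurable_sets[OF h2] cell_measurable)

section \<open>The approximating measures: convergence on rectangles, additivity, marginals\<close>

lemma measure_Times:
  assumes "A \<in> sets M1" "B \<in> sets M2"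
  shows "measure (M1 \<Otimes>\<^sub>M M2) (A \<times> B) = measure M1 A * measure M2 B"
  using M2.emeasure_pair_measure_Times[OF assms]
  by (simp add: measure_def enn2real_mult)

lemma approx_Times:
  assumes "A \<in> sets M1" "B \<in> sets M2"
  shows "approx n (A \<times> B) = (\<Sum>I\<in>Pow {..<n}. measure M1 (A \<inter> (h1 -` C n I \<inter> space M1)) *
    measure M2 (B \<inter> (h2 -` C n I \<inter> space M2)) / measure M0 (C n I))"
  unfolding fiber_approx_def fiber_box_def Times_Int_Times
  using assms by (intro sum.cong refl, subst measure_Times) auto

lemma pull1_le: "D \<in> sets M0 \<Longrightarrow> measure M1 (A \<inter> (h1 -` D \<inter> space M1)) \<le> measure M0 D"
  by (metis M1.finite_measure_mono Int_lower2 measurable_sets[OF h1] push1)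

lemma pull2_le: "D \<in> sets M0 \<Longrightarrow> measure M2 (B \<inter> (h2 -` D \<inter> space M2)) \<le> measure M0 D"
  by (metis M2.finite_measure_mono Int_lower2 measurable_sets[OF h2] push2)

lemma pull_additive:
  assumes "finite_measure M" "h \<in> M \<rightarrow>\<^sub>M M0" "A \<in> sets M" "D \<in> sets M0" "Q \<in> sets M0"
  shows "measure M (A \<inter> (h -` D \<inter> space M)) =
    measure M (A \<inter> (h -` (D - Q) \<inter> space M)) + measure M (A \<inter> (h -` (D \<inter> Q) \<inter> space M))"
proof -
  interpret finite_measure M by fact
  have "A \<inter> (h -` (D - Q) \<inter> space M) \<in> sets M" "A \<inter> (h -` (D \<inter> Q) \<inter> space M) \<in> sets M"
    using assms by auto
  moreover have "(A \<inter> (h -` (D - Q) \<inter> space M)) \<inter> (A \<inter> (h -` (D \<inter> Q) \<inter> space M)) = {}"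
    by auto
  moreover have "A \<inter> (h -` D \<inter> space M) =
      A \<inter> (h -` (D - Q) \<inter> space M) \<union> A \<inter> (h -` (D \<inter> Q) \<inter> space M)" by auto
  ultimately show ?thesis by (metis finite_measure_Union)
qed

lemma M0_additive: "D \<in> sets M0 \<Longrightarrow> Q \<in> sets M0 \<Longrightarrow>
    measure M0 D = measure M0 (D - Q) + measure M0 (D \<inter> Q)"
  by (subst M0.finite_measure_Union[symmetric]) (auto intro!: arg_cong[where f="measure M0"])

text \<open>On a rectangle the product measure factors, so each summand has the form
  \<open>u D * v D / m D\<close> with \<open>u\<close> and \<open>v\<close> additive in the cell
  \<open>D\<close> and dominated by \<open>m\<close>, the measure \<open>M0\<close>.\<close>

lemma approx_tendsto:
  assumes "A \<in> sets M1" "B \<in> sets M2"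
  shows "(\<lambda>n. approx n (A \<times> B)) \<longlonglongrightarrow> \<gamma> (A \<times> B)"
proof -
  have "convergent (\<lambda>n. approx n (A \<times> B))"
    unfolding approx_Times[OF assms]
    by (rule product_sums_convergent
        [where u="\<lambda>D. measure M1 (A \<inter> (h1 -` D \<inter> space M1))" and
          v="\<lambda>D. measure M2 (B \<inter> (h2 -` D \<inter> space M2))", OF U
          pull_additive[OF M1.finite_measure_axioms h1 assms(1)]
          pull_additive[OF M2.finite_measure_axioms h2 assms(2)] M0_additive])
      (simp_all add: pull1_le pull2_le)
  then show ?thesis
    unfolding fiber_lim_def by (simp add: convergent_LIMSEQ_iff)
qed

lemma approx_nonneg: "0 \<le> approx n Z"
  unfolding fiber_approx_def by (intro sum_nonneg) simp

lemma approx_mono: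
  assumes "Z \<subseteq> Z'" "Z' \<in> sets (M1 \<Otimes>\<^sub>M M2)"
  shows "approx n Z \<le> approx n Z'"
  unfolding fiber_approx_def
  using assms by (intro sum_mono divide_right_mono P.finite_measure_mono) auto

lemma approx_UN_le:
  assumes "finite J" "\<And>j. j \<in> J \<Longrightarrow> Z j \<in> sets (M1 \<Otimes>\<^sub>M M2)"
  shows "approx n (\<Union>j\<in>J. Z j) \<le> (\<Sum>j\<in>J. approx n (Z j))"
proof -
  have "measure (M1 \<Otimes>\<^sub>M M2) ((\<Union>j\<in>J. Z j) \<inter> W) \<le> (\<Sum>j\<in>J. measure (M1 \<Otimes>\<^sub>M M2) (Z j \<inter> W))"
    if "W \<in> sets (M1 \<Otimes>\<^sub>M M2)" for W
    using measure_UNION_le[of J "\<lambda>j. Z j \<inter> W" "M1 \<Otimes>\<^sub>M M2"] assms that by auto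
  then have "approx n (\<Union>j\<in>J. Z j) \<le> (\<Sum>I\<in>Pow {..<n}.
      (\<Sum>j\<in>J. measure (M1 \<Otimes>\<^sub>M M2) (Z j \<inter> fiber_box M1 M2 M0 h1 h2 U n I)) / measure M0 (C n I))"
    unfolding fiber_approx_def by (intro sum_mono divide_right_mono) auto
  also have "\<dots> = (\<Sum>j\<in>J. approx n (Z j))"
    unfolding fiber_approx_def sum_divide_distrib by (rule sum.swap)
  finally show ?thesis .
qed

lemma approx_UN_disjoint:
  assumes "finite J" "\<And>j. j \<in> J \<Longrightarrow> Z j \<in> sets (M1 \<Otimes>\<^sub>M M2)" "disjoint_family_on Z J"
  shows "approx n (\<Union>j\<in>J. Z j) = (\<Sum>j\<in>J. approx n (Z j))"
proof -
  have "measure (M1 \<Otimes>\<^sub>M M2) ((\<Union>j\<in>J. Z j) \<inter> W) = (\<Sum>j\<in>J. measure (M1 \<Otimes>\<^sub>M M2) (Z j \<inter> W))"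
    if "W \<in> sets (M1 \<Otimes>\<^sub>M M2)" for W
  proof -
    have "measure (M1 \<Otimes>\<^sub>M M2) (\<Union>j\<in>J. Z j \<inter> W) = (\<Sum>j\<in>J. measure (M1 \<Otimes>\<^sub>M M2) (Z j \<inter> W))"
      using assms that by (intro P.finite_measure_finite_Union) (auto simp: disjoint_family_on_def)
    then show ?thesis by simp
  qed
  then have "approx n (\<Union>j\<in>J. Z j) = (\<Sum>I\<in>Pow {..<n}.
      (\<Sum>j\<in>J. measure (M1 \<Otimes>\<^sub>M M2) (Z j \<inter> fiber_box M1 M2 M0 h1 h2 U n I)) / measure M0 (C n I))"
    unfolding fiber_approx_def by (intro sum.cong refl) simp
  also have "\<dots> = (\<Sum>j\<in>J. approx n (Z j))"
    unfolding fiber_approx_def sum_divide_distrib by (rule sum.swap)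
  finally show ?thesis .
qed

text \<open>With the whole space as second side, the factor from \<open>M2\<close> equals the
  denominator by \<open>push2\<close> and cancels. On cells of \<open>M0\<close>-measure 0 the
  factor from \<open>M1\<close> is 0 too, so nothing is lost there; the cells then add up to
  \<open>A\<close>.\<close>

lemma approx_marginal1:
  assumes A: "A \<in> sets M1"
  shows "approx n (A \<times> space M2) = measure M1 A"
proof -
  have "approx n (A \<times> space M2) = (\<Sum>I\<in>Pow {..<n}. measure M1 (A \<inter> (h1 -` C n I \<inter> space M1)))"
    unfolding approx_Times[OF A sets.top]
  proof (intro sum.cong refl)
    fix I
    have "measure M2 (space M2 \<inter> (h2 -` C n I \<inter> space M2)) = measure M0 (C n I)"
      by (simp add: push2 Int_absorb1)
    moreover have "measure M1 (A \<inter> (h1 -` C n I \<inter> space M1)) = 0" if "measure M0 (C n I) = 0"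
      using pull1_le[of "C n I" A] that by (simp add: measure_le_0_iff)
    ultimately show "measure M1 (A \<inter> (h1 -` C n I \<inter> space M1)) *
        measure M2 (space M2 \<inter> (h2 -` C n I \<inter> space M2)) / measure M0 (C n I) =
        measure M1 (A \<inter> (h1 -` C n I \<inter> space M1))" by auto
  qed
  also have "\<dots> = measure M1 (A \<inter> (h1 -` space M0 \<inter> space M1))"
    by (rule sum_cells[where u="\<lambda>D. measure M1 (A \<inter> (h1 -` D \<inter> space M1))", OF U
        pull_additive[OF M1.finite_measure_axioms h1 A]])
  also have "A \<inter> (h1 -` space M0 \<inter> space M1) = A"
    using sets.sets_into_space[OF A] measurable_space[OF h1] by auto
  finally show ?thesis .
qed

lemma approx_marginal2:
  assumes B: "B \<in> sets M2"
  shows "approx n (space M1 \<times> B) = measure M2 B"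
proof -
  have "approx n (space M1 \<times> B) = (\<Sum>I\<in>Pow {..<n}. measure M2 (B \<inter> (h2 -` C n I \<inter> space M2)))"
    unfolding approx_Times[OF sets.top B]
  proof (intro sum.cong refl)
    fix I
    have "measure M1 (space M1 \<inter> (h1 -` C n I \<inter> space M1)) = measure M0 (C n I)"
      by (simp add: push1 Int_absorb1)
    moreover have "measure M2 (B \<inter> (h2 -` C n I \<inter> space M2)) = 0" if "measure M0 (C n I) = 0"
      using pull2_le[of "C n I" B] that by (simp add: measure_le_0_iff)
    ultimately show "measure M1 (space M1 \<inter> (h1 -` C n I \<inter> space M1)) *
        measure M2 (B \<inter> (h2 -` C n I \<inter> space M2)) / measure M0 (C n I) =
        measure M2 (B \<inter> (h2 -` C n I \<inter> space M2))" by auto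
  qed
  also have "\<dots> = measure M2 (B \<inter> (h2 -` space M0 \<inter> space M2))"
    by (rule sum_cells[where u="\<lambda>D. measure M2 (B \<inter> (h2 -` D \<inter> space M2))", OF U
        pull_additive[OF M2.finite_measure_axioms h2 B]])
  also have "B \<inter> (h2 -` space M0 \<inter> space M2) = B"
    using sets.sets_into_space[OF B] measurable_space[OF h2] by auto
  finally show ?thesis .
qed

section \<open>Marginals and finite additivity properties of the limit\<close>

lemma lim_marginal1: "A \<in> sets M1 \<Longrightarrow> \<gamma> (A \<times> space M2) = measure M1 A"
  using approx_tendsto[of A "space M2"] by (simp add: approx_marginal1 LIMSEQ_const_iff)

lemma lim_marginal2: "B \<in> sets M2 \<Longrightarrow> \<gamma> (space M1 \<times> B) = measure M2 B"
  using approx_tendsto[of "space M1" B] by (simp add: approx_marginal2 LIMSEQ_const_iff)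

lemma lim_nonneg: "A \<in> sets M1 \<Longrightarrow> B \<in> sets M2 \<Longrightarrow> 0 \<le> \<gamma> (A \<times> B)"
  by (rule LIMSEQ_le_const[OF approx_tendsto]) (auto simp: approx_nonneg)

text \<open>Each \<open>approx n\<close> is monotone and finitely subadditive, and the inequality
  survives the limit. It speaks of rectangles throughout because convergence is known for
  them.\<close>

lemma lim_cover_le:
  assumes "finite J" and K: "K \<in> sets M1" "L \<in> sets M2"
    and AB: "\<And>j. j \<in> J \<Longrightarrow> A j \<in> sets M1" "\<And>j. j \<in> J \<Longrightarrow> B j \<in> sets M2"
    and cover: "K \<times> L \<subseteq> (\<Union>j\<in>J. A j \<times> B j)"
  shows "\<gamma> (K \<times> L) \<le> (\<Sum>j\<in>J. \<gamma> (A j \<times> B j))"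
proof (rule LIMSEQ_le[OF approx_tendsto[OF K]])
  show "(\<lambda>n. \<Sum>j\<in>J. approx n (A j \<times> B j)) \<longlonglongrightarrow> (\<Sum>j\<in>J. \<gamma> (A j \<times> B j))"
    using AB by (intro tendsto_sum approx_tendsto)
  have "approx n (K \<times> L) \<le> approx n (\<Union>j\<in>J. A j \<times> B j)" for n
    using AB assms(1) by (intro approx_mono cover sets.finite_UN pair_measureI) auto
  moreover have "approx n (\<Union>j\<in>J. A j \<times> B j) \<le> (\<Sum>j\<in>J. approx n (A j \<times> B j))" for n
    using AB assms(1) by (intro approx_UN_le) auto
  ultimately show "\<exists>N. \<forall>n\<ge>N. approx n (K \<times> L) \<le> (\<Sum>j\<in>J. approx n (A j \<times> B j))"
    by (meson order_trans)
qed

text \<open>The counterpart of \<open>lim_cover_le\<close> for disjoint rectangles inside a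
  rectangle, from finite additivity of each \<open>approx n\<close>.\<close>

lemma lim_packing_le:
  assumes "finite J" and K: "K \<in> sets M1" "L \<in> sets M2"
    and AB: "\<And>j. j \<in> J \<Longrightarrow> A j \<in> sets M1" "\<And>j. j \<in> J \<Longrightarrow> B j \<in> sets M2"
    and sub: "\<And>j. j \<in> J \<Longrightarrow> A j \<times> B j \<subseteq> K \<times> L" and disj: "disjoint_family_on (\<lambda>j. A j \<times> B j) J"
  shows "(\<Sum>j\<in>J. \<gamma> (A j \<times> B j)) \<le> \<gamma> (K \<times> L)"
proof (rule LIMSEQ_le[OF _ approx_tendsto[OF K]])
  show "(\<lambda>n. \<Sum>j\<in>J. approx n (A j \<times> B j)) \<longlonglongrightarrow> (\<Sum>j\<in>J. \<gamma> (A j \<times> B j))"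
    using AB by (intro tendsto_sum approx_tendsto)
  have "(\<Sum>j\<in>J. approx n (A j \<times> B j)) = approx n (\<Union>j\<in>J. A j \<times> B j)" for n
    using AB assms(1) disj by (intro approx_UN_disjoint[symmetric]) auto
  moreover have "approx n (\<Union>j\<in>J. A j \<times> B j) \<le> approx n (K \<times> L)" for n
    using K by (intro approx_mono UN_least sub) auto
  ultimately show "\<exists>N. \<forall>n\<ge>N. (\<Sum>j\<in>J. approx n (A j \<times> B j)) \<le> approx n (K \<times> L)" by auto
qed

text \<open>\<open>A \<times> B\<close> is covered by \<open>K \<times> L\<close> and two strips,
  \<open>A - K\<close> times the whole space and the whole space times \<open>B - L\<close>, whose
  values are marginals. It serves both to shrink a rectangle to a compact one and to compare an open
  rectangle with the one it encloses.\<close>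

lemma lim_le_perturb:
  assumes A: "A \<in> sets M1" "B \<in> sets M2" and K: "K \<in> sets M1" "L \<in> sets M2"
  shows "\<gamma> (A \<times> B) \<le> \<gamma> (K \<times> L) + measure M1 (A - K) + measure M2 (B - L)"
proof -
  define F where "F = (\<lambda>j::nat. if j = 0 then K else if j = 1 then A - K else space M1)"
  define G where "G = (\<lambda>j::nat. if j = 0 then L else if j = 1 then space M2 else B - L)"
  have "\<gamma> (A \<times> B) \<le> (\<Sum>j\<in>{0,1,2}. \<gamma> (F j \<times> G j))"
  proof (rule lim_cover_le)
    show "A \<times> B \<subseteq> (\<Union>j\<in>{0,1,2}. F j \<times> G j)"
      using sets.sets_into_space[OF A(1)] sets.sets_into_space[OF A(2)]
      by (auto simp: F_def G_def)
  qed (use A K in \<open>auto simp: F_def G_def\<close>)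
  also have "\<dots> = \<gamma> (K \<times> L) + measure M1 (A - K) + measure M2 (B - L)"
    using A K by (simp add: F_def G_def lim_marginal1 lim_marginal2)
  finally show ?thesis .
qed

text \<open>For \<open>n > i\<close> every cell lies inside \<open>U i\<close> or misses it.\<close>

lemma lim_off_diagonal:
  shows "\<gamma> ((h1 -` U i \<inter> space M1) \<times> (h2 -` (space M0 - U i) \<inter> space M2)) = 0" (is "\<gamma> (?A \<times> ?B) = 0")
    and "\<gamma> ((h1 -` (space M0 - U i) \<inter> space M1) \<times> (h2 -` U i \<inter> space M2)) = 0" (is "\<gamma> (?A' \<times> ?B') = 0")
proof -
  have "?A \<in> sets M1" "?B \<in> sets M2" "?A' \<in> sets M1" "?B' \<in> sets M2" by auto
  note t = approx_tendsto[OF this(1,2)] approx_tendsto[OF this(3,4)]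
  have box: "(?A \<times> ?B) \<inter> fiber_box M1 M2 M0 h1 h2 U n I = {}"
      "(?A' \<times> ?B') \<inter> fiber_box M1 M2 M0 h1 h2 U n I = {}" if "Suc i \<le> n" for n I
    using that by (auto simp: fiber_box_def cell_def)
  have "approx n (?A \<times> ?B) = 0" "approx n (?A' \<times> ?B') = 0" if "Suc i \<le> n" for n
    by (simp_all add: fiber_approx_def box[OF that])
  note z = this
  have "(\<lambda>n. approx n (?A \<times> ?B)) \<longlonglongrightarrow> 0"
    by (rule tendsto_eventually, rule eventually_sequentiallyI[of "Suc i"], rule z(1))
  then show "\<gamma> (?A \<times> ?B) = 0" by (rule LIMSEQ_unique[OF t(1)])
  have "(\<lambda>n. approx n (?A' \<times> ?B')) \<longlonglongrightarrow> 0"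
    by (rule tendsto_eventually, rule eventually_sequentiallyI[of "Suc i"], rule z(2))
  then show "\<gamma> (?A' \<times> ?B') = 0" by (rule LIMSEQ_unique[OF t(2)])
qed

end

text \<open>A difference of rectangles splits into two disjoint rectangles,
  \<open>(a - c) \<times> b\<close> and \<open>(a \<inter> c) \<times> (b - d)\<close>.
  Caratheodory's theorem is applied on this semiring.\<close>

lemma semiring_of_sets_Times:
  "semiring_of_sets (space M \<times> space N) {a \<times> b | a b. a \<in> sets M \<and> b \<in> sets N}"
  (is "semiring_of_sets _ ?R")
proof
  show "?R \<subseteq> Pow (space M \<times> space N)" by (rule pair_measure_closed)
  show "{} \<in> ?R" by (auto intro!: exI[of _ "{}"])
  show "a \<inter> b \<in> ?R" if "a \<in> ?R" "b \<in> ?R" for a b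
    using that Int_stable_pair_measure_generator[of M N] by (simp add: Int_stable_def)
  show "\<exists>C\<subseteq>?R. finite C \<and> disjoint C \<and> x - y = \<Union>C" if xy: "x \<in> ?R" "y \<in> ?R" for x y
  proof -
    obtain a b where x: "x = a \<times> b" "a \<in> sets M" "b \<in> sets N" using xy(1) by auto
    obtain c d where y: "y = c \<times> d" "c \<in> sets M" "d \<in> sets N" using xy(2) by auto
    have "{(a - c) \<times> b, (a \<inter> c) \<times> (b - d)} \<subseteq> ?R"
      using x y by blast
    moreover have "disjoint {(a - c) \<times> b, (a \<inter> c) \<times> (b - d)}"
      by (auto simp: disjoint_def)
    moreover have "x - y = \<Union>{(a - c) \<times> b, (a \<inter> c) \<times> (b - d)}"
      by (auto simp: x y)
    ultimately show ?thesis by blast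
  qed
qed

section \<open>Countable additivity and the extension to a measure\<close>

context fiber_coupling
begin

text \<open>Finite packings bound the series from above by the whole. Conversely, a compact
  rectangle nearly filling \<open>K \<times> L\<close> is covered by slightly enlarged open
  rectangles; a finite subcover reduces the claim to \<open>lim_cover_le\<close>.\<close>

lemma lim_sums:
  assumes T: "Hausdorff_space T1" "Hausdorff_space T2"
    and R: "finite_radon_measure T1 M1" "finite_radon_measure T2 M2"
    and AB: "\<And>i. A i \<in> sets M1" "\<And>i. B i \<in> sets M2" and KL: "K \<in> sets M1" "L \<in> sets M2"
    and disj: "disjoint_family (\<lambda>i. A i \<times> B i)" and UN: "(\<Union>i. A i \<times> B i) = K \<times> L"
  shows "(\<lambda>i::nat. \<gamma> (A i \<times> B i)) sums \<gamma> (K \<times> L)"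
proof -
  let ?g = "\<lambda>i. \<gamma> (A i \<times> B i)"
  have s1: "sets M1 = sets (borel_of T1)" and s2: "sets M2 = sets (borel_of T2)"
    using R by (auto simp: finite_radon_measure_def)
  have g0: "0 \<le> ?g i" for i using AB by (intro lim_nonneg)
  have part: "sum ?g J \<le> \<gamma> (K \<times> L)" if "finite J" for J
    using UN disj by (intro lim_packing_le that KL AB) (auto simp: disjoint_family_on_def)
  have sm: "summable ?g"
    by (rule summableI_nonneg_bounded[of _ "\<gamma> (K \<times> L)"]) (auto simp: g0 part)
  have "suminf ?g \<le> \<gamma> (K \<times> L)"
    by (rule suminf_le_const[OF sm]) (simp add: part)
  moreover have "\<gamma> (K \<times> L) \<le> suminf ?g"
  proof (rule field_le_epsilon)
    fix \<epsilon> :: real assume "\<epsilon> > 0"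
    \<comment> \<open>Four errors of at most \<open>e\<close> each: two from shrinking
      \<open>K\<close> and \<open>L\<close>, two from enlarging all the \<open>A i\<close> and all
      the \<open>B i\<close>, where the weights \<open>d i\<close> add up to
      \<open>e\<close>.\<close>
    define e where "e = \<epsilon> / 4"
    have e: "e > 0" using \<open>\<epsilon> > 0\<close> by (simp add: e_def)
    define d where "d i = e * (1/2) ^ Suc i" for i
    have d0: "d i > 0" for i using e by (simp add: d_def)
    have dsums: "d sums e"
      unfolding d_def using sums_mult[OF power_half_series, of e] by simp
    obtain K' where K': "K' \<subseteq> K" "compactin T1 K'" "measure M1 (K - K') < e"
      using R(1) KL(1) e unfolding finite_radon_measure_def by blast
    obtain L' where L': "L' \<subseteq> L" "compactin T2 L'" "measure M2 (L - L') < e"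
      using R(2) KL(2) e unfolding finite_radon_measure_def by blast
    have KL': "K' \<in> sets M1" "L' \<in> sets M2"
      using borel_of_compact T K' L' s1 s2 by auto
    have "\<exists>V. openin T1 V \<and> A i \<subseteq> V \<and> measure M1 (V - A i) < d i" for i
      using finite_radon_outer[OF T(1) R(1) AB(1) d0] by metis
    then obtain V where V: "\<And>i. openin T1 (V i)" "\<And>i. A i \<subseteq> V i" "\<And>i. measure M1 (V i - A i) < d i"
      by metis
    have "\<exists>W. openin T2 W \<and> B i \<subseteq> W \<and> measure M2 (W - B i) < d i" for i
      using finite_radon_outer[OF T(2) R(2) AB(2) d0] by metis
    then obtain W where W: "\<And>i. openin T2 (W i)" "\<And>i. B i \<subseteq> W i" "\<And>i. measure M2 (W i - B i) < d i"
      by metis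
    have VW: "V i \<in> sets M1" "W i \<in> sets M2" for i
      using borel_of_open V(1) W(1) s1 s2 by auto
    have cpt: "compactin (prod_topology T1 T2) (K' \<times> L')"
      using K'(2) L'(2) by (simp add: compactin_Times)
    have cov: "K' \<times> L' \<subseteq> \<Union>(range (\<lambda>i. V i \<times> W i))"
    proof -
      have "K' \<times> L' \<subseteq> K \<times> L" using K'(1) L'(1) by auto
      also have "\<dots> \<subseteq> (\<Union>i. V i \<times> W i)" unfolding UN[symmetric] using V(2) W(2) by fast
      finally show ?thesis .
    qed
    have op: "openin (prod_topology T1 T2) Z" if "Z \<in> range (\<lambda>i. V i \<times> W i)" for Z
      using that V(1) W(1) by (auto simp: openin_prod_Times_iff)
    obtain F where F: "finite F" "F \<subseteq> range (\<lambda>i. V i \<times> W i)" "K' \<times> L' \<subseteq> \<Union>F"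
      using compactinD[OF cpt op cov] by blast
    from finite_subset_image[OF F(1,2)] obtain J
      where "finite J" "F = (\<lambda>i. V i \<times> W i) ` J" by blast
    with F(3) have J: "finite J" "K' \<times> L' \<subseteq> (\<Union>i\<in>J. V i \<times> W i)" by simp_all
    have "\<gamma> (K \<times> L) \<le> \<gamma> (K' \<times> L') + measure M1 (K - K') + measure M2 (L - L')"
      by (intro lim_le_perturb KL KL')
    also have "\<dots> \<le> \<gamma> (K' \<times> L') + 2 * e" using K'(3) L'(3) by linarith
    also have "\<gamma> (K' \<times> L') \<le> (\<Sum>i\<in>J. \<gamma> (V i \<times> W i))"
      by (intro lim_cover_le J KL' VW)
    also have "\<dots> \<le> (\<Sum>i\<in>J. ?g i + 2 * d i)"
    proof (intro sum_mono)
      fix i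
      have "\<gamma> (V i \<times> W i) \<le> ?g i + measure M1 (V i - A i) + measure M2 (W i - B i)"
        by (intro lim_le_perturb AB VW)
      then show "\<gamma> (V i \<times> W i) \<le> ?g i + 2 * d i" using V(3)[of i] W(3)[of i] by linarith
    qed
    also have "\<dots> = sum ?g J + 2 * sum d J" by (simp add: sum.distrib sum_distrib_left)
    also have "sum ?g J \<le> suminf ?g"
      by (intro sum_le_suminf sm J) (auto simp: g0)
    also have "sum d J \<le> e"
      using sum_le_suminf[OF sums_summable[OF dsums] J(1)] sums_unique[OF dsums] d0
      by (simp add: less_imp_le)
    finally show "\<gamma> (K \<times> L) \<le> suminf ?g + \<epsilon>" by (simp add: e_def)
  qed
  ultimately have "suminf ?g = \<gamma> (K \<times> L)" by (rule antisym)
  with sm show ?thesis by (simp only: sums_iff simp_thms)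
qed

text \<open>Caratheodory's theorem on the semiring of rectangles; \<open>lim_sums\<close> supplies
  the countable additivity.\<close>

lemma fiber_measure_exists:
  assumes T: "Hausdorff_space T1" "Hausdorff_space T2"
    and R: "finite_radon_measure T1 M1" "finite_radon_measure T2 M2"
  obtains N where "sets N = sets (M1 \<Otimes>\<^sub>M M2)"
    and "\<And>A B. A \<in> sets M1 \<Longrightarrow> B \<in> sets M2 \<Longrightarrow> emeasure N (A \<times> B) = ennreal (\<gamma> (A \<times> B))"
proof -
  let ?R = "{a \<times> b | a b. a \<in> sets M1 \<and> b \<in> sets M2}"
  interpret S: semiring_of_sets "space M1 \<times> space M2" ?R
    by (rule semiring_of_sets_Times)
  have "\<gamma> {} = 0" using lim_marginal1[of "{}"] by simp
  then have "positive ?R (\<lambda>Z. ennreal (\<gamma> Z))" by (simp add: positive_def)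
  moreover have "countably_additive ?R (\<lambda>Z. ennreal (\<gamma> Z))"
    unfolding countably_additive_def
  proof (intro allI impI)
    fix F :: "nat \<Rightarrow> _"
    assume F: "range F \<subseteq> ?R" "disjoint_family F" "\<Union> (range F) \<in> ?R"
    have "\<exists>a b. F i = a \<times> b \<and> a \<in> sets M1 \<and> b \<in> sets M2" for i using F(1) by blast
    then obtain A B where AB: "\<And>i. F i = A i \<times> B i" "\<And>i. A i \<in> sets M1" "\<And>i. B i \<in> sets M2"
      by metis
    obtain K L where KL: "\<Union> (range F) = K \<times> L" "K \<in> sets M1" "L \<in> sets M2"
      using F(3) by blast
    have "(\<lambda>i. \<gamma> (A i \<times> B i)) sums \<gamma> (K \<times> L)"
      using F(2) KL(1) by (intro lim_sums[OF T R] AB KL) (simp_all add: AB(1)[abs_def])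
    then show "(\<Sum>i. ennreal (\<gamma> (F i))) = ennreal (\<gamma> (\<Union> (range F)))"
      unfolding KL(1) AB(1) by (intro suminf_ennreal_eq lim_nonneg AB)
  qed
  ultimately obtain \<mu>' where \<mu>': "\<forall>s\<in>?R. \<mu>' s = ennreal (\<gamma> s)"
      "measure_space (space M1 \<times> space M2) (sigma_sets (space M1 \<times> space M2) ?R) \<mu>'"
    using S.caratheodory by blast
  define N where "N = measure_of (space M1 \<times> space M2) ?R \<mu>'"
  have N: "sets N = sets (M1 \<Otimes>\<^sub>M M2)"
    by (simp add: N_def sets_pair_measure pair_measure_closed)
  moreover have "emeasure N (A \<times> B) = ennreal (\<gamma> (A \<times> B))" if "A \<in> sets M1" "B \<in> sets M2" for A B
  proof -
    have "emeasure N (A \<times> B) = \<mu>' (A \<times> B)"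
    proof (rule emeasure_measure_of[OF N_def pair_measure_closed])
      show "A \<times> B \<in> sets N" using that by (simp add: N)
      show "positive (sets N) \<mu>'" "countably_additive (sets N) \<mu>'"
        using \<mu>'(2) by (simp_all add: measure_space_def N sets_pair_measure)
    qed
    then show ?thesis using \<mu>'(1) that by auto
  qed
  ultimately show thesis by (rule that)
qed

end

section \<open>Semipullbacks\<close>

text \<open>Dynkin's \<pi>-\<lambda> argument: rectangles are stable under intersection, and the
  property passes to complements, by finiteness of \<open>N x\<close>, and to countable disjoint
  unions.\<close>

lemma kernel_pair_measurable:
  assumes fin: "\<And>x. x \<in> space X \<Longrightarrow> finite_measure (N x)"
    and sets: "\<And>x. x \<in> space X \<Longrightarrow> sets (N x) = sets (M1 \<Otimes>\<^sub>M M2)"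
    and meas: "\<And>A B. A \<in> sets M1 \<Longrightarrow> B \<in> sets M2 \<Longrightarrow> (\<lambda>x. measure (N x) (A \<times> B)) \<in> borel_measurable X"
    and Z: "Z \<in> sets (M1 \<Otimes>\<^sub>M M2)"
  shows "(\<lambda>x. measure (N x) Z) \<in> borel_measurable X"
  using Int_stable_pair_measure_generator pair_measure_closed Z unfolding sets_pair_measure
proof (induction rule: sigma_sets_induct_disjoint)
  case (basic A)
  then show ?case using meas by auto
next
  case empty
  then show ?case by simp
next
  case (compl Z)
  let ?\<Omega> = "space M1 \<times> space M2"
  have "measure (N x) (?\<Omega> - Z) = measure (N x) ?\<Omega> - measure (N x) Z" if x: "x \<in> space X" for x
  proof -
    interpret finite_measure "N x" using fin x .
    have "space (N x) = ?\<Omega>" using sets_eq_imp_space_eq[OF sets[OF x]] by (simp add: space_pair_measure)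
    moreover have "Z \<in> sets (N x)" using compl(1) sets[OF x] by (simp add: sets_pair_measure)
    ultimately show ?thesis using finite_measure_compl by metis
  qed
  moreover have "(\<lambda>x. measure (N x) ?\<Omega> - measure (N x) Z) \<in> borel_measurable X"
    using compl(2) by (intro borel_measurable_diff meas) auto
  ultimately show ?case by (simp cong: measurable_cong)
next
  case (union F)
  have "measure (N x) (\<Union>i. F i) = (\<Sum>i. measure (N x) (F i))" if x: "x \<in> space X" for x
  proof -
    interpret finite_measure "N x" using fin x .
    have "range F \<subseteq> sets (N x)" using union(2) sets[OF x] by (simp add: sets_pair_measure)
    then show ?thesis using finite_measure_UNION[of F] union(1) by (simp add: sums_iff)
  qed
  moreover have "(\<lambda>x. \<Sum>i. measure (N x) (F i)) \<in> borel_measurable X"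
    using union(3) by (intro borel_measurable_suminf)
  ultimately show ?case by (simp cong: measurable_cong)
qed

theorem theorem2p2:
  fixes X :: "'x measure"
    and S1 :: "'a metric" and \<mu>1 :: "'x \<Rightarrow> 'a measure"
    and S2 :: "'b metric" and \<mu>2 :: "'x \<Rightarrow> 'b measure"
    and S0 :: "'c metric" and \<mu>0 :: "'x \<Rightarrow> 'c measure"
    and h1 :: "'a \<Rightarrow> 'c" and h2 :: "'b \<Rightarrow> 'c"
  assumes "rk_cospan X S1 \<mu>1 S2 \<mu>2 S0 \<mu>0 h1 h2"
  shows "(\<exists>\<mu>3 :: 'x \<Rightarrow> ('a \<times> 'b) measure.
            rk_semipullback X S1 \<mu>1 S2 \<mu>2 h1 h2 (metric_pullback S1 S2 h1 h2) \<mu>3 fst snd) \<and>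
         set_pullback (mspace S1) (mspace S2) h1 h2 \<in> sets (mborel S1 \<Otimes>\<^sub>M mborel S2)"
proof -
  have obj: "rk_object X S1 \<mu>1" "rk_object X S2 \<mu>2" "rk_object X S0 \<mu>0"
    and mor: "kernel_morphism X (mborel S1) \<mu>1 (mborel S0) \<mu>0 h1"
      "kernel_morphism X (mborel S2) \<mu>2 (mborel S0) \<mu>0 h2"
    using assms by (auto simp: rk_cospan_def rk_morphism_def)
  have sc: "second_countable (mtopology_of S1)" "second_countable (mtopology_of S2)"
      "second_countable (mtopology_of S0)"
    using obj by (auto simp: rk_object_def intro: second_countable_mtopology_of)
  note H1 = Hausdorff_space_mtopology_of[of S1] and H2 = Hausdorff_space_mtopology_of[of S2]
    and H0 = Hausdorff_space_mtopology_of[of S0]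
  have h1 [measurable]: "h1 \<in> mborel S1 \<rightarrow>\<^sub>M mborel S0" and h2 [measurable]: "h2 \<in> mborel S2 \<rightarrow>\<^sub>M mborel S0"
    and surj: "h1 ` mspace S1 = mspace S0" "h2 ` mspace S2 = mspace S0"
    using mor by (auto simp: kernel_morphism_def)
  have fin: "finite_measure (\<mu>1 x)" "finite_measure (\<mu>2 x)" "finite_measure (\<mu>0 x)"
    and sets [measurable_cong]: "sets (\<mu>1 x) = sets (mborel S1)" "sets (\<mu>2 x) = sets (mborel S2)" "sets (\<mu>0 x) = sets (mborel S0)"
    if "x \<in> space X" for x
    using that obj by (auto simp: rk_object_def radon_subprob_kernel_def subprob_kernel_def kernel_def)
  have sp: "space (\<mu>1 x) = mspace S1" "space (\<mu>2 x) = mspace S2" "space (\<mu>0 x) = mspace S0"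
    if "x \<in> space X" for x
    using sets[OF that, THEN sets_eq_imp_space_eq] by simp_all
  have meas: "A \<in> sets (mborel S1) \<Longrightarrow> (\<lambda>x. measure (\<mu>1 x) A) \<in> borel_measurable X"
      "B \<in> sets (mborel S2) \<Longrightarrow> (\<lambda>x. measure (\<mu>2 x) B) \<in> borel_measurable X"
      "D \<in> sets (mborel S0) \<Longrightarrow> (\<lambda>x. measure (\<mu>0 x) D) \<in> borel_measurable X" for A B D
    using obj by (auto simp: rk_object_def radon_subprob_kernel_def subprob_kernel_def kernel_def)
  have radon: "finite_radon_measure (mtopology_of S1) (\<mu>1 x)" "finite_radon_measure (mtopology_of S2) (\<mu>2 x)"
    if "x \<in> space X" for x
    using that obj fin[OF that] H1 H2
    by (auto simp: rk_object_def radon_subprob_kernel_def intro: radon_imp_finite_radon)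
  obtain U :: "nat \<Rightarrow> 'c set" where "\<forall>i. openin (mtopology_of S0) (U i)"
    and sep: "\<forall>a\<in>mspace S0. \<forall>b\<in>mspace S0. (\<forall>i. a \<in> U i \<longleftrightarrow> b \<in> U i) \<longrightarrow> a = b"
    using separating_open_sequence[OF sc(3) H0] unfolding topspace_mtopology_of by blast
  then have U: "openin (mtopology_of S0) (U i)" for i by simp
  have Us [measurable]: "U i \<in> sets (mborel S0)" for i by (intro borel_of_open U)

  \<comment> \<open>Measurability of the set pullback\<close>
  define S3 where "S3 = set_pullback (mspace S1) (mspace S2) h1 h2"
  \<comment> \<open>A pair lies outside the pullback exactly when some \<open>U i\<close> contains
    one of its two images but not the other. \<open>O1 i\<close> and \<open>O2 i\<close> are the two
    possibilities, so the complement of \<open>S3\<close> is a countable union of measurable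
    rectangles.\<close>
  define O1 where "O1 i = (h1 -` U i \<inter> mspace S1) \<times> (h2 -` (mspace S0 - U i) \<inter> mspace S2)" for i
  define O2 where "O2 i = (h1 -` (mspace S0 - U i) \<inter> mspace S1) \<times> (h2 -` U i \<inter> mspace S2)" for i
  let ?P = "mborel S1 \<Otimes>\<^sub>M mborel S2"
  have spP: "space ?P = mspace S1 \<times> mspace S2" by (simp add: space_pair_measure)
  have vim1: "h1 -` D \<inter> mspace S1 \<in> sets (mborel S1)" and vim2: "h2 -` D \<inter> mspace S2 \<in> sets (mborel S2)"
    if "D \<in> sets (mborel S0)" for D
    using measurable_sets[OF h1 that] measurable_sets[OF h2 that] by simp_all
  have compl0: "mspace S0 - U i \<in> sets (mborel S0)" for i
    using sets.compl_sets[OF Us[of i]] by simp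
  have Os: "O1 i \<in> sets ?P" "O2 i \<in> sets ?P" for i
    unfolding O1_def O2_def by (intro pair_measureI vim1 vim2 Us compl0)+
  have S3_eq: "mspace S1 \<times> mspace S2 - S3 = (\<Union>i. O1 i \<union> O2 i)"
  proof
    show "mspace S1 \<times> mspace S2 - S3 \<subseteq> (\<Union>i. O1 i \<union> O2 i)"
    proof
      fix z assume z: "z \<in> mspace S1 \<times> mspace S2 - S3"
      then obtain a b where ab: "z = (a, b)" "a \<in> mspace S1" "b \<in> mspace S2" "h1 a \<noteq> h2 b"
        by (auto simp: S3_def set_pullback_def)
      then have m: "h1 a \<in> mspace S0" "h2 b \<in> mspace S0" using surj by auto
      then obtain i where "\<not> (h1 a \<in> U i \<longleftrightarrow> h2 b \<in> U i)" using sep m ab(4) by blast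
      then have "z \<in> O1 i \<union> O2 i" using ab m by (auto simp: O1_def O2_def)
      then show "z \<in> (\<Union>i. O1 i \<union> O2 i)" by blast
    qed
  qed (auto simp: O1_def O2_def S3_def set_pullback_def)
  have S3_sub: "S3 \<subseteq> mspace S1 \<times> mspace S2" by (auto simp: S3_def set_pullback_def)
  have "S3 = space ?P - (\<Union>i. O1 i \<union> O2 i)"
    using S3_eq S3_sub spP by (simp add: double_diff flip: S3_eq)
  moreover have "space ?P - (\<Union>i. O1 i \<union> O2 i) \<in> sets ?P"
    by (intro sets.compl_sets sets.countable_UN) (auto intro: sets.Un Os)
  ultimately have S3s: "S3 \<in> sets ?P" by simp

  \<comment> \<open>The conditional product over each point of the parameter space\<close>
  have coup: "fiber_coupling (\<mu>1 x) (\<mu>2 x) (\<mu>0 x) h1 h2 U" if x: "x \<in> space X" for x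
  proof -
    have "h1 \<in> \<mu>1 x \<rightarrow>\<^sub>M \<mu>0 x" "h2 \<in> \<mu>2 x \<rightarrow>\<^sub>M \<mu>0 x"
      using h1 h2 sets[OF x] by (simp_all cong: measurable_cong_sets)
    moreover have "measure (\<mu>1 x) (h1 -` A \<inter> space (\<mu>1 x)) = measure (\<mu>0 x) A"
        "measure (\<mu>2 x) (h2 -` A \<inter> space (\<mu>2 x)) = measure (\<mu>0 x) A" if "A \<in> sets (\<mu>0 x)" for A
      using mor x that sets[OF x] sp[OF x] by (auto simp: kernel_morphism_def measure_def)
    moreover have "U i \<in> sets (\<mu>0 x)" for i using sets[OF x] Us by simp
    ultimately show ?thesis
      using fin[OF x] by (simp add: fiber_coupling_def fiber_coupling_axioms_def)
  qed
  define \<gamma> where "\<gamma> x = fiber_lim (\<mu>1 x) (\<mu>2 x) (\<mu>0 x) h1 h2 U" for x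
  \<comment> \<open>\<open>N\<close> is chosen separately for each \<open>x\<close>. Measurability
    in \<open>x\<close> is not lost, because the values on rectangles are prescribed by
    \<open>\<gamma> x\<close>, built from one sequence \<open>U\<close> common to all
    \<open>x\<close>.\<close>
  have "\<exists>N. sets N = sets ?P \<and> (\<forall>A\<in>sets (mborel S1). \<forall>B\<in>sets (mborel S2).
      emeasure N (A \<times> B) = ennreal (\<gamma> x (A \<times> B)))" if x: "x \<in> space X" for x
  proof -
    interpret fiber_coupling "\<mu>1 x" "\<mu>2 x" "\<mu>0 x" h1 h2 U using coup[OF x] .
    show ?thesis
      using fiber_measure_exists[OF H1 H2 radon[OF x]] unfolding \<gamma>_def sets_pair_measure_cong[OF sets(1,2)[OF x]] sets[OF x]
      by metis
  qed
  then obtain N where Ns: "\<And>x. x \<in> space X \<Longrightarrow> sets (N x) = sets ?P"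
    and Nt: "\<And>x A B. x \<in> space X \<Longrightarrow> A \<in> sets (mborel S1) \<Longrightarrow> B \<in> sets (mborel S2) \<Longrightarrow>
      emeasure (N x) (A \<times> B) = ennreal (\<gamma> x (A \<times> B))"
    by metis
  have Nsp: "space (N x) = mspace S1 \<times> mspace S2" if "x \<in> space X" for x
    using sets_eq_imp_space_eq[OF Ns[OF that]] spP by simp
  have marg1: "emeasure (N x) (A \<times> mspace S2) = emeasure (\<mu>1 x) A"
    if x: "x \<in> space X" and A: "A \<in> sets (mborel S1)" for x A
  proof -
    interpret fiber_coupling "\<mu>1 x" "\<mu>2 x" "\<mu>0 x" h1 h2 U using coup[OF x] .
    show ?thesis
      using Nt[OF x A, of "mspace S2"] lim_marginal1[of A] A sets.top[of "mborel S2"]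
      by (simp add: sets[OF x] sp[OF x] \<gamma>_def M1.emeasure_eq_measure)
  qed
  have marg2: "emeasure (N x) (mspace S1 \<times> B) = emeasure (\<mu>2 x) B"
    if x: "x \<in> space X" and B: "B \<in> sets (mborel S2)" for x B
  proof -
    interpret fiber_coupling "\<mu>1 x" "\<mu>2 x" "\<mu>0 x" h1 h2 U using coup[OF x] .
    show ?thesis
      using Nt[OF x _ B, of "mspace S1"] lim_marginal2[of B] B sets.top[of "mborel S1"]
      by (simp add: sets[OF x] sp[OF x] \<gamma>_def M2.emeasure_eq_measure)
  qed
  have Nfin: "finite_measure (N x)" if x: "x \<in> space X" for x
  proof (rule finite_measureI)
    have "emeasure (N x) (space (N x)) = emeasure (\<mu>1 x) (mspace S1)"
      using marg1[OF x, of "mspace S1"] sets.top[of "mborel S1"] by (simp add: Nsp[OF x])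
    then show "emeasure (N x) (space (N x)) \<noteq> \<infinity>"
      using finite_measure.emeasure_finite[OF fin(1)[OF x]] by simp
  qed
  \<comment> \<open>\<open>O1 i\<close> and \<open>O2 i\<close> are the rectangles of
    \<open>lim_off_diagonal\<close>, so \<open>N x\<close> is concentrated on
    \<open>S3\<close>.\<close>
  have null: "(\<Union>i. O1 i \<union> O2 i) \<in> null_sets (N x)" if x: "x \<in> space X" for x
  proof -
    interpret fiber_coupling "\<mu>1 x" "\<mu>2 x" "\<mu>0 x" h1 h2 U using coup[OF x] .
    have "emeasure (N x) (O1 i) = 0" "emeasure (N x) (O2 i) = 0" for i
      using lim_off_diagonal[of i] Nt[OF x vim1 vim2, OF Us compl0, of i i] Nt[OF x vim1 vim2, OF compl0 Us, of i i]
      by (simp_all add: O1_def O2_def sp[OF x] \<gamma>_def)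
    then have "O1 i \<in> null_sets (N x)" "O2 i \<in> null_sets (N x)" for i
      using Os Ns[OF x] by (simp_all add: null_sets_def)
    then show ?thesis by (intro null_sets_UN null_sets.Un)
  qed
  have N_S3: "emeasure (N x) (Z \<inter> S3) = emeasure (N x) Z" if x: "x \<in> space X" and Z: "Z \<in> sets ?P" for x Z
  proof -
    have "Z \<inter> S3 = Z - (\<Union>i. O1 i \<union> O2 i)"
      using sets.sets_into_space[OF Z] S3_sub unfolding S3_eq[symmetric] spP by auto
    then show ?thesis using emeasure_Diff_null_set[OF null[OF x]] Z Ns[OF x] by simp
  qed
  have Nrad: "finite_radon_measure (prod_topology (mtopology_of S1) (mtopology_of S2)) (N x)" if x: "x \<in> space X" for x
  proof (rule finite_radon_pair[OF H1 H2 sc(1,2) radon[OF x] Nfin[OF x]])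
    show "sets (N x) = sets (\<mu>1 x \<Otimes>\<^sub>M \<mu>2 x)"
      using Ns[OF x] sets_pair_measure_cong[OF sets(1,2)[OF x]] by simp
    show "measure (N x) (A \<times> space (\<mu>2 x)) = measure (\<mu>1 x) A" if "A \<in> sets (\<mu>1 x)" for A
      using marg1[OF x, of A] that by (simp add: sets[OF x] sp[OF x] measure_def)
    show "measure (N x) (space (\<mu>1 x) \<times> B) = measure (\<mu>2 x) B" if "B \<in> sets (\<mu>2 x)" for B
      using marg2[OF x, of B] that by (simp add: sets[OF x] sp[OF x] measure_def)
  qed
  have Nmeas: "(\<lambda>x. measure (N x) (A \<times> B)) \<in> borel_measurable X"
    if A: "A \<in> sets (mborel S1)" and B: "B \<in> sets (mborel S2)" for A B
  proof -
    let ?c = "cell (mspace S0) U"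
    \<comment> \<open>The approximations written with \<open>mspace\<close> in place of
      \<open>space (\<mu>1 x)\<close> and its analogues: the sets no longer depend on
      \<open>x\<close>, so each summand is built from measurable functions of \<open>x\<close> by
      products and quotients.\<close>
    let ?a = "\<lambda>n x. \<Sum>I\<in>Pow {..<n}. measure (\<mu>1 x) (A \<inter> (h1 -` ?c n I \<inter> mspace S1)) *
      measure (\<mu>2 x) (B \<inter> (h2 -` ?c n I \<inter> mspace S2)) / measure (\<mu>0 x) (?c n I)"
    have c: "?c n I \<in> sets (mborel S0)" for n I
      using cell_sets[of U "mborel S0" n I] Us by simp
    have "measure (N x) (A \<times> B) = lim (\<lambda>n. ?a n x)" if x: "x \<in> space X" for x
    proof -
      interpret fiber_coupling "\<mu>1 x" "\<mu>2 x" "\<mu>0 x" h1 h2 U using coup[OF x] .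
      have AB: "A \<in> sets (\<mu>1 x)" "B \<in> sets (\<mu>2 x)" using A B sets[OF x] by simp_all
      show ?thesis
        using Nt[OF x A B] lim_nonneg[OF AB] approx_Times[OF AB]
        by (simp add: measure_def \<gamma>_def fiber_lim_def sp[OF x])
    qed
    moreover have "(\<lambda>x. lim (\<lambda>n. ?a n x)) \<in> borel_measurable X"
      using A B by (intro borel_measurable_lim_metric borel_measurable_sum borel_measurable_divide
          borel_measurable_times meas sets.Int vim1 vim2 c)
    ultimately show ?thesis by (simp cong: measurable_cong)
  qed

  \<comment> \<open>The kernel on the set pullback\<close>
  define \<mu>3 where "\<mu>3 x = restrict_space (N x) S3" for x
  let ?S3 = "metric_pullback S1 S2 h1 h2"
  have top3: "mtopology_of ?S3 = subtopology (prod_topology (mtopology_of S1) (mtopology_of S2)) S3"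
    by (simp add: metric_pullback_def S3_def mtopology_of_submetric)
  have ms3: "mspace ?S3 = S3"
    using S3_sub by (auto simp: metric_pullback_def S3_def)
  have sets3: "sets (mborel ?S3) = sets (restrict_space ?P S3)"
  proof -
    have "sets (borel_of (prod_topology (mtopology_of S1) (mtopology_of S2))) = sets ?P"
      by (intro sets_borel_of_prod_topology sc)
    then show ?thesis
      using sets_borel_of_subtopology[of S3 "prod_topology (mtopology_of S1) (mtopology_of S2)"] S3s
      by (simp add: top3 cong: sets_restrict_space_cong)
  qed
  have Q3: "Q \<in> sets (mborel ?S3) \<longleftrightarrow> Q \<subseteq> S3 \<and> Q \<in> sets ?P" for Q
    unfolding sets3 using S3s by (intro sets_restrict_space_iff) auto
  have S3N: "S3 \<in> sets (N x)" if "x \<in> space X" for x using S3s Ns[OF that] by simp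
  have e3: "emeasure (\<mu>3 x) Q = emeasure (N x) Q" if "x \<in> space X" "Q \<subseteq> S3" for x Q
    unfolding \<mu>3_def using S3N[OF that(1)] that(2) by (intro emeasure_restrict_space) auto
  have obj3: "rk_object X ?S3 \<mu>3"
    unfolding rk_object_def radon_subprob_kernel_def subprob_kernel_def kernel_def
  proof (intro conjI ballI)
    \<comment> \<open>Separability need not pass to subspaces of a topological space, whereas second
      countability does.\<close>
    show "separable_space (mtopology_of ?S3)"
      unfolding top3
      by (intro second_countable_imp_separable_space second_countable_subtopology
          second_countable_prod_topology sc)
    fix x assume x: "x \<in> space X"
    show "sets (\<mu>3 x) = sets (mborel ?S3)"
      unfolding \<mu>3_def sets3 by (intro sets_restrict_space_cong Ns x)
    show "finite_measure (\<mu>3 x)"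
      unfolding \<mu>3_def by (intro finite_measure_restrict_space Nfin S3N x)
    \<comment> \<open>Restriction to \<open>S3\<close> loses no mass, so the total mass is that of
      the first marginal \<open>\<mu>1 x\<close>.\<close>
    have "emeasure (\<mu>3 x) (space (mborel ?S3)) = emeasure (N x) S3"
      by (simp add: e3[OF x] ms3)
    also have "\<dots> = emeasure (N x) (mspace S1 \<times> mspace S2)"
      using N_S3[OF x, of "mspace S1 \<times> mspace S2"] sets.top[of ?P] S3_sub by (simp add: spP Int_absorb1)
    also have "\<dots> = emeasure (\<mu>1 x) (mspace S1)"
      using marg1[OF x, of "mspace S1"] sets.top[of "mborel S1"] by simp
    also have "\<dots> \<le> 1"
      using obj(1) x by (simp add: rk_object_def radon_subprob_kernel_def subprob_kernel_def)
    finally show "emeasure (\<mu>3 x) (space (mborel ?S3)) \<le> 1" .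
    show "radon_measure (mtopology_of ?S3) (\<mu>3 x)"
    proof (rule finite_radon_imp_radon[OF Hausdorff_space_mtopology_of])
      show "finite_radon_measure (mtopology_of ?S3) (\<mu>3 x)"
        unfolding top3 \<mu>3_def by (intro finite_radon_restrict Nrad S3N x)
    qed
  next
    fix Q assume Q: "Q \<in> sets (mborel ?S3)"
    have "(\<lambda>x. measure (N x) Q) \<in> borel_measurable X"
      using kernel_pair_measurable[OF Nfin Ns Nmeas] Q Q3 by blast
    moreover have "measure (\<mu>3 x) Q = measure (N x) Q" if "x \<in> space X" for x
      using e3[OF that] Q Q3 by (simp add: measure_def)
    ultimately show "(\<lambda>x. measure (\<mu>3 x) Q) \<in> borel_measurable X"
      by (simp cong: measurable_cong)
  qed

  \<comment> \<open>The coordinate projections as kernel morphisms\<close>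
  have "kernel_morphism X (mborel ?S3) \<mu>3 (mborel S1) \<mu>1 fst"
    unfolding kernel_morphism_def
  proof (intro conjI ballI)
    have "fst \<in> restrict_space ?P S3 \<rightarrow>\<^sub>M mborel S1"
      by (intro measurable_restrict_space1 measurable_fst)
    then show "fst \<in> mborel ?S3 \<rightarrow>\<^sub>M mborel S1"
      using measurable_cong_sets[OF sets3 refl] by blast
    \<comment> \<open>A partner for \<open>a\<close> exists because \<open>h2\<close> maps onto the
      whole base space, which contains \<open>h1 a\<close>.\<close>
    have "a \<in> fst ` S3" if a: "a \<in> mspace S1" for a
    proof -
      obtain b where "b \<in> mspace S2" "h1 a = h2 b"
        using surj a by (metis imageE imageI)
      with a have "(a, b) \<in> S3" by (simp add: S3_def set_pullback_def)
      then show ?thesis by force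
    qed
    then show "fst ` space (mborel ?S3) = space (mborel S1)"
      using S3_sub by (auto simp: ms3)
    fix x A assume x: "x \<in> space X" and A: "A \<in> sets (mborel S1)"
    have AP: "A \<times> mspace S2 \<in> sets ?P" using A sets.top[of "mborel S2"] by auto
    have "fst -` A \<inter> space (mborel ?S3) = (A \<times> mspace S2) \<inter> S3"
      using S3_sub by (auto simp: ms3)
    then show "emeasure (\<mu>3 x) (fst -` A \<inter> space (mborel ?S3)) = emeasure (\<mu>1 x) A"
      by (simp add: e3[OF x] N_S3[OF x AP] marg1[OF x A])
  qed
  moreover have "kernel_morphism X (mborel ?S3) \<mu>3 (mborel S2) \<mu>2 snd"
    unfolding kernel_morphism_def
  proof (intro conjI ballI)
    have "snd \<in> restrict_space ?P S3 \<rightarrow>\<^sub>M mborel S2"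
      by (intro measurable_restrict_space1 measurable_snd)
    then show "snd \<in> mborel ?S3 \<rightarrow>\<^sub>M mborel S2"
      using measurable_cong_sets[OF sets3 refl] by blast
    have "b \<in> snd ` S3" if b: "b \<in> mspace S2" for b
    proof -
      obtain a where "a \<in> mspace S1" "h1 a = h2 b"
        using surj b by (metis imageE imageI)
      with b have "(a, b) \<in> S3" by (simp add: S3_def set_pullback_def)
      then show ?thesis by force
    qed
    then show "snd ` space (mborel ?S3) = space (mborel S2)"
      using S3_sub by (auto simp: ms3)
    fix x B assume x: "x \<in> space X" and B: "B \<in> sets (mborel S2)"
    have BP: "mspace S1 \<times> B \<in> sets ?P" using B sets.top[of "mborel S1"] by auto
    have "snd -` B \<inter> space (mborel ?S3) = (mspace S1 \<times> B) \<inter> S3"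
      using S3_sub by (auto simp: ms3)
    then show "emeasure (\<mu>3 x) (snd -` B \<inter> space (mborel ?S3)) = emeasure (\<mu>2 x) B"
      by (simp add: e3[OF x] N_S3[OF x BP] marg2[OF x B])
  qed
  ultimately have "rk_semipullback X S1 \<mu>1 S2 \<mu>2 h1 h2 ?S3 \<mu>3 fst snd"
    using obj obj3 by (auto simp: rk_semipullback_def rk_morphism_def ms3 S3_def set_pullback_def)
  with S3s show ?thesis unfolding S3_def by blast
qed

end
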